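(* Let $S$ be the substitution monad on $[\mathcal H^{\mathrm{op}},\mathbf{Set}]$, i.e. the monad induced by the free-forgetful adjunction $\{s\}\text{-}\mathbf{GAT}\leftrightarrows[\mathcal H^{\mathrm{op}},\mathbf{Set}]$. The value at $X\in[\mathcal H^{\mathrm{op}},\mathbf{Set}]$ of its underlying endofunctor has (under the identification given in the context) type-elements and boundaries given by $$SX(n)=\sum_{\alpha\in\mathrm{Inc}(n)}[\mathcal H^{\mathrm{op}},\mathbf{Set}]([\alpha],X),\qquad\partial\colon SX(n+1)\to SX(n),\ (\alpha,h)\mapsto(\partial\alpha,\partial h),$$ and term-elements $\mathrm{Tm}_{SX}(\alpha,h)=\mathrm{Tm}_X(h(\alpha(n)))$ for each $(\alpha,h)\in SX(n)$.
   Context: \textbf{Expressions and judgements.} Fix a denumerable set $\mathrm{Var}$ of variables. Given an alphabet $\Xi$, the expressions over $\Xi$ are generated as follows: each $x\in\mathrm{Var}$ is an expression; if $n\geq 0$, $e_1,\dots,e_n$ are expressions and $w\in\Xi$, then $w(e_1,\dots,e_n)$ is an expression (written $w$ when $n=0$). $e'[e/x]$ denotes substitution of $e$ for $x$ in $e'$. A context is a (possibly empty) list $x_1:T_1,\dots,x_n:T_n$ of distinct variables $x_i$ and expressions $T_i$. A judgement is a string $\Gamma\vdash T\ \mathsf{type}$ (type judgement), $\Gamma\vdash t:T$ (term judgement), $\Gamma\vdash T=T'\ \mathsf{type}$ (type equality) or $\Gamma\vdash t=t':T$ (term equality), with $\Gamma$ a context and $t,t',T,T'$ expressions; its degree is one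 more than the length of $\Gamma$. The boundary of a judgement is a list of judgements: $\partial(\vdash T\ \mathsf{type})=()$; $\partial(\Gamma,x:T\vdash T'\ \mathsf{type})=(\Gamma\vdash T\ \mathsf{type})$; $\partial(\Gamma\vdash t:T)=(\Gamma\vdash T\ \mathsf{type})$; $\partial(\Gamma\vdash T=T'\ \mathsf{type})=(\Gamma\vdash T\ \mathsf{type},\ \Gamma\vdash T'\ \mathsf{type})$; $\partial(\Gamma\vdash t=t':T)=(\Gamma\vdash t:T,\ \Gamma\vdash t':T)$. \textbf{Deduction rules} (premises $\Longrightarrow$ conclusion; $\mathcal J$ stands for the right-hand side of any of the four judgement forms). \emph{Equality and $\alpha$ rules}: $\Gamma\vdash t:T\Longrightarrow\Gamma\vdash t=t:T$; $\Gamma\vdash t_1=t_2:T\Longrightarrow\Gamma\vdash t_2=t_1:T$; $\Gamma\vdash t_1=t_2:T$ and $\Gamma\vdash t_2=t_3:T\Longrightarrow\Gamma\vdash t_1=t_3:T$; $\Gamma\vdash T\ \mathsf{type}\Longrightarrow\Gamma\vdash T=T\ \mathsf{type}$; $\Gamma\vdash T_1=T_2\ \mathsf{type}\Longrightarrow\Gamma\vdash T_2=T_1\ \mathsf{type}$; $\Gamma\vdash T_1=T_2\ \mathsf{type}$ and $\Gamma\vdash T_2=T_3\ \mathsf{type}\Longrightarrow\Gamma\vdash T_1=T_3\ \mathsf{type}$; $\Gamma\vdash T_1=T_2\ \mathsf{type}$ and $\Gamma\vdash t:T_1\Longrightarrow\Gamma\vdash t:T_2$; $\Gamma\vdash T_1=T_2\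 \mathsf{type}$ and $\Gamma\vdash t_1=t_2:T_1\Longrightarrow\Gamma\vdash t_1=t_2:T_2$; $\Gamma\vdash\mathcal J\Longrightarrow\sigma\cdot\Gamma\vdash\sigma\cdot\mathcal J$ for any permutation $\sigma\in\mathrm{Sym}(\mathrm{Var})$ acting on variables. \emph{Substitution} ($s$): $\Gamma\vdash t:T$ and $\Gamma,y:T,\Delta\vdash\mathcal J\Longrightarrow\Gamma,\Delta[t/y]\vdash\mathcal J[t/y]$; $\Gamma\vdash t_1=t_2:T$ and $\Gamma,y:T,\Delta\vdash T'\ \mathsf{type}\Longrightarrow\Gamma,\Delta[t_2/y]\vdash T'[t_1/y]=T'[t_2/y]\ \mathsf{type}$; $\Gamma\vdash t_1=t_2:T$ and $\Gamma,y:T,\Delta\vdash t':T'\Longrightarrow\Gamma,\Delta[t_2/y]\vdash t'[t_1/y]=t'[t_2/y]:T'[t_2/y]$. \textbf{$\{s\}$-GATs.} An $\{s\}$-GAT $\mathbb T$ consists of a collection $\Omega$ of type-constants, a collection $\Sigma$ of term-constants and a collection $\Lambda$ of basic judgements over $\Omega\amalg\Sigma$ such that: for each $A\in\Omega$ there is a unique judgement in $\Lambda$ of the form $x_1:T_1,\dots,x_{n-1}:T_{n-1}\vdash A(x_1,\dots,x_{n-1})\ \mathsf{type}$; for each $f\in\Sigma$ there is a unique judgement in $\Lambda$ of the form $x_1:T_1,\dots,x_{n-1}:T_{n-1}\vdash f(x_1,\dots,x_{n-1}):T$; all other elements of $\Lambda$ are type or term equality judgements; each element of $\Lambda$ lies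 in $\mathbb T^*$. Here $\mathbb T^*$, the collection of derived judgements, is the smallest collection closed under all the rules listed above and containing $\mathcal J\in\Lambda$ whenever it contains each judgement in $\partial(\mathcal J)$. An interpretation $\phi\colon\mathbb T\to\mathbb U$ is a function $\phi\colon\mathbb T^*\to\mathbb U^*$ preserving boundaries and preserving deduction: viewing each rule with $n$ premises (for each choice of parameters such as $\sigma$) as an $n$-ary partial function $r$ on judgements, $\phi(r(\mathcal J_1,\dots,\mathcal J_n))=r(\phi(\mathcal J_1),\dots,\phi(\mathcal J_n))$ whenever both sides are defined. On derived type judgements, $(x_1:S_1,\dots,x_{n-1}:S_{n-1}\vdash S_n\ \mathsf{type})\equiv(y_1:T_1,\dots,y_{m-1}:T_{m-1}\vdash T_m\ \mathsf{type})$ iff $n=m$ and for $1\le i\le n$ the judgement $x_1:S_1,\dots,x_{i-1}:S_{i-1}\vdash S_i=T_i[x_1/y_1,\dots,x_{i-1}/y_{i-1}]\ \mathsf{type}$ is derived. On derived term judgements, $(x_1:S_1,\dots,x_{n-1}:S_{n-1}\vdash s:S_n)\equiv(y_1:T_1,\dots,y_{m-1}:T_{m-1}\vdash t:T_m)$ iff their boundaries are $\equiv$ and $x_1:S_1,\dots,x_{n-1}:S_{n-1}\vdash s=t[x_1/y_1,\dots,x_{n-1}/y_{n-1}]:S_n$ is derived. $\{s\}\text{-}\mathbf{GAT}$ has $\{s\}$-GATs as objects and, as morphisms, interpretations modulo: $\phi\sim\phi'$ iff $\phi(\mathcal J)\equiv\phi'(\mathcal J)$ for each derived type or term judgement $\mathcal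 J$. \textbf{Type-and-term structures and the monad.} $[a,b]=\{a,\dots,b\}\subset\mathbb N$ and $[n]=[1,n]$. $\mathcal H$ is the category freely generated by the graph with objects $n$ and $n_t$ ($n\ge1$) and arrows $n\to n+1$ and $n\to n_t$. For $X\in[\mathcal H^{\mathrm{op}},\mathbf{Set}]$ the maps $X(n+1)\to X(n)$, $X(n_t)\to X(n)$ are written $\partial$; elements of $X(n)$ are type-elements, elements of $X(n_t)$ term-elements; for $A\in X(n)$, $\mathrm{Tm}_X(A)=\{a\in X(n_t):\partial a=A\}$. A presheaf is specified by its type-elements, their boundaries and the sets $\mathrm{Tm}_X(A)$. The forgetful functor $V\colon\{s\}\text{-}\mathbf{GAT}\to[\mathcal H^{\mathrm{op}},\mathbf{Set}]$ has $V\mathbb T(n)$ (resp. $V\mathbb T(n_t)$) the set of derived type (resp. term) judgements of degree $n$ modulo $\equiv$, boundaries induced by $\partial$, and $V\phi([\mathcal J])=[\phi(\mathcal J)]$. Its left adjoint $G$ sends $X$ to the free $\{s\}$-GAT $GX$ whose type- and term-constants are the type- and term-elements of $X$ and whose basic judgements are $x_1:A_1,x_2:A_2(x_1),\dots,x_{n-1}:A_{n-1}(x_1,\dots,x_{n-2})\vdash A(x_1,\dots,x_{n-1})\ \mathsf{type}$ for $A\in X(n)$, where $A_i=\partial^{n-i}A$, and, in the same context, $\dots\vdash a(x_1,\dots,x_{n-1}):A(x_1,\dots,x_{n-1})$ for $a\in\mathrm{Tm}_X(A)$. Thus $S=VG$. \textbf{Inc-lists.} An inc-list of length $n$ is a strictly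 increasing function $\alpha\colon[0,n]\to\mathbb N$ with $\alpha(0)=0$; $\mathrm{Inc}(n)$ is the set of these. For $\alpha\in\mathrm{Inc}(n+1)$, $\partial\alpha\in\mathrm{Inc}(n)$ is its restriction to $[0,n]$. The presheaf $[\alpha]$ has $[\alpha](i)=\{i\}$ if $i\le\alpha(n)$ and $\emptyset$ otherwise, $[\alpha](i_t)=\{i_t\}$ if $i\le\alpha(n)$ and $i\notin\mathrm{Im}\,\alpha$ and $\emptyset$ otherwise, with the unique possible boundary maps. For $h\colon[\alpha]\to X$ with $\alpha$ of length $>1$, $\partial h$ is the restriction of $h$ along the inclusion $[\partial\alpha]\to[\alpha]$. \textbf{Identification.} Given $\alpha\in\mathrm{Inc}(n)$ and $h\colon[\alpha]\to X$, define expressions recursively for $1\le j\le\alpha(n)$ by $e_j=x_m$ if $j=\alpha(m)$ and $e_j=h(j_t)(e_1,\dots,e_{j-1})$ if $j\notin\mathrm{Im}\,\alpha$. The pair $(\alpha,h)$ corresponds to the class of $x_1:T_1,\dots,x_{n-1}:T_{n-1}\vdash T_n\ \mathsf{type}$ with $T_i=h(\alpha(i))(e_1,\dots,e_{\alpha(i)-1})$, and $a\in\mathrm{Tm}_X(h(\alpha(n)))$ to the class of $x_1:T_1,\dots,x_{n-1}:T_{n-1}\vdash a(e_1,\dots,e_{\alpha(n)-1}):T_n$. *)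

theory Defs
  imports "HOL-Library.FuncSet"
begin

section \<open>Expressions and judgements\<close>

type_synonym var = nat

datatype (symbols: 'w) expr = Var var | App 'w "'w expr list"

text \<open>
  Simultaneous substitution. The substitution of \<open>e\<close> for the single variable \<open>x\<close> is
  \<open>subst (Var(x := e))\<close>, and a permutation \<open>\<sigma>\<close> of the variables acts as \<open>subst (Var \<circ> \<sigma>)\<close>.
\<close>

primrec subst :: "(var \<Rightarrow> 'w expr) \<Rightarrow> 'w expr \<Rightarrow> 'w expr" where
  "subst \<theta> (Var x) = \<theta> x"
| "subst \<theta> (App w es) = App w (map (subst \<theta>) es)"

definition renaming :: "var list \<Rightarrow> var list \<Rightarrow> var \<Rightarrow> 'w expr" where
  "renaming xs ys v = (case map_of (zip ys xs) v of None \<Rightarrow> Var v | Some x \<Rightarrow> Var x)"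

type_synonym 'w ctx = "(var \<times> 'w expr) list"

datatype (rhs_symbols: 'w) rhs =
    IsType "'w expr"
  | HasType "'w expr" "'w expr"             \<comment> \<open>\<open>HasType t T\<close> is \<open>t : T\<close>\<close>
  | TypeEq "'w expr" "'w expr"
  | TermEq "'w expr" "'w expr" "'w expr"    \<comment> \<open>\<open>TermEq t t' T\<close> is \<open>t = t' : T\<close>\<close>

datatype (judgement_symbols: 'w) judgement =
  Judgement (ctx_of: "(var \<times> 'w expr) list") (rhs_of: "'w rhs") (infix \<open>\<turnstile>\<close> 50)

definition judgements :: "'w set \<Rightarrow> 'w judgement set" where
  "judgements \<Xi> = {J. distinct (map fst (ctx_of J)) \<and> judgement_symbols J \<subseteq> \<Xi>}"

primrec subst_rhs :: "(var \<Rightarrow> 'w expr) \<Rightarrow> 'w rhs \<Rightarrow> 'w rhs" where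
  "subst_rhs \<theta> (IsType T) = IsType (subst \<theta> T)"
| "subst_rhs \<theta> (HasType t T) = HasType (subst \<theta> t) (subst \<theta> T)"
| "subst_rhs \<theta> (TypeEq T T') = TypeEq (subst \<theta> T) (subst \<theta> T')"
| "subst_rhs \<theta> (TermEq t t' T) = TermEq (subst \<theta> t) (subst \<theta> t') (subst \<theta> T)"

definition subst_ctx :: "(var \<Rightarrow> 'w expr) \<Rightarrow> 'w ctx \<Rightarrow> 'w ctx" where
  "subst_ctx \<theta> \<Gamma> = map (\<lambda>(x, T). (x, subst \<theta> T)) \<Gamma>"

definition permute_ctx :: "(var \<Rightarrow> var) \<Rightarrow> 'w ctx \<Rightarrow> 'w ctx" where
  "permute_ctx \<sigma> \<Gamma> = map (\<lambda>(x, T). (\<sigma> x, subst (Var \<circ> \<sigma>) T)) \<Gamma>"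

definition degree :: "'w judgement \<Rightarrow> nat" where
  "degree J = Suc (length (ctx_of J))"

definition is_type_judgement :: "'w judgement \<Rightarrow> bool" where
  "is_type_judgement J \<longleftrightarrow> (\<exists>\<Gamma> T. J = (\<Gamma> \<turnstile> IsType T))"

definition is_term_judgement :: "'w judgement \<Rightarrow> bool" where
  "is_term_judgement J \<longleftrightarrow> (\<exists>\<Gamma> t T. J = (\<Gamma> \<turnstile> HasType t T))"

definition is_equality_judgement :: "'w judgement \<Rightarrow> bool" where
  "is_equality_judgement J \<longleftrightarrow>
     (\<exists>\<Gamma> T T'. J = (\<Gamma> \<turnstile> TypeEq T T')) \<or> (\<exists>\<Gamma> t t' T. J = (\<Gamma> \<turnstile> TermEq t t' T))"

fun boundary :: "'w judgement \<Rightarrow> 'w judgement list" where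
  "boundary (\<Gamma> \<turnstile> IsType T) =
     (if \<Gamma> = [] then [] else [butlast \<Gamma> \<turnstile> IsType (snd (last \<Gamma>))])"
| "boundary (\<Gamma> \<turnstile> HasType t T) = [\<Gamma> \<turnstile> IsType T]"
| "boundary (\<Gamma> \<turnstile> TypeEq T T') = [\<Gamma> \<turnstile> IsType T, \<Gamma> \<turnstile> IsType T']"
| "boundary (\<Gamma> \<turnstile> TermEq t t' T) = [\<Gamma> \<turnstile> HasType t T, \<Gamma> \<turnstile> HasType t' T]"


section \<open>Generalised algebraic theories with substitution as only structural rule\<close>

text \<open>
  The alphabet of a theory is the disjoint union of its type-constants (injected by \<open>Inl\<close>) and
  its term-constants (injected by \<open>Inr\<close>).
\<close>

record ('o, 's) gat =
  type_consts :: "'o set"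
  term_consts :: "'s set"
  basic :: "('o + 's) judgement set"

inductive_set derived :: "('o, 's, 'z) gat_scheme \<Rightarrow> ('o + 's) judgement set"
  for \<T> :: "('o, 's, 'z) gat_scheme" where
  basic: "\<lbrakk>J \<in> basic \<T>; \<And>J'. J' \<in> set (boundary J) \<Longrightarrow> J' \<in> derived \<T>\<rbrakk> \<Longrightarrow> J \<in> derived \<T>"
| term_refl: "(\<Gamma> \<turnstile> HasType t T) \<in> derived \<T> \<Longrightarrow> (\<Gamma> \<turnstile> TermEq t t T) \<in> derived \<T>"
| term_sym: "(\<Gamma> \<turnstile> TermEq t1 t2 T) \<in> derived \<T> \<Longrightarrow> (\<Gamma> \<turnstile> TermEq t2 t1 T) \<in> derived \<T>"
| term_trans: "\<lbrakk>(\<Gamma> \<turnstile> TermEq t1 t2 T) \<in> derived \<T>; (\<Gamma> \<turnstile> TermEq t2 t3 T) \<in> derived \<T>\<rbrakk>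
    \<Longrightarrow> (\<Gamma> \<turnstile> TermEq t1 t3 T) \<in> derived \<T>"
| type_refl: "(\<Gamma> \<turnstile> IsType T) \<in> derived \<T> \<Longrightarrow> (\<Gamma> \<turnstile> TypeEq T T) \<in> derived \<T>"
| type_sym: "(\<Gamma> \<turnstile> TypeEq T1 T2) \<in> derived \<T> \<Longrightarrow> (\<Gamma> \<turnstile> TypeEq T2 T1) \<in> derived \<T>"
| type_trans: "\<lbrakk>(\<Gamma> \<turnstile> TypeEq T1 T2) \<in> derived \<T>; (\<Gamma> \<turnstile> TypeEq T2 T3) \<in> derived \<T>\<rbrakk>
    \<Longrightarrow> (\<Gamma> \<turnstile> TypeEq T1 T3) \<in> derived \<T>"
| conv: "\<lbrakk>(\<Gamma> \<turnstile> TypeEq T1 T2) \<in> derived \<T>; (\<Gamma> \<turnstile> HasType t T1) \<in> derived \<T>\<rbrakk>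
    \<Longrightarrow> (\<Gamma> \<turnstile> HasType t T2) \<in> derived \<T>"
| conv_eq: "\<lbrakk>(\<Gamma> \<turnstile> TypeEq T1 T2) \<in> derived \<T>; (\<Gamma> \<turnstile> TermEq t1 t2 T1) \<in> derived \<T>\<rbrakk>
    \<Longrightarrow> (\<Gamma> \<turnstile> TermEq t1 t2 T2) \<in> derived \<T>"
| alpha: "\<lbrakk>(\<Gamma> \<turnstile> \<J>) \<in> derived \<T>; bij \<sigma>\<rbrakk>
    \<Longrightarrow> (permute_ctx \<sigma> \<Gamma> \<turnstile> subst_rhs (Var \<circ> \<sigma>) \<J>) \<in> derived \<T>"
| subst: "\<lbrakk>(\<Gamma> \<turnstile> HasType t T) \<in> derived \<T>; (\<Gamma> @ (y, T) # \<Delta> \<turnstile> \<J>) \<in> derived \<T>\<rbrakk>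
    \<Longrightarrow> (\<Gamma> @ subst_ctx (Var(y := t)) \<Delta> \<turnstile> subst_rhs (Var(y := t)) \<J>) \<in> derived \<T>"
| subst_type_eq:
    "\<lbrakk>(\<Gamma> \<turnstile> TermEq t1 t2 T) \<in> derived \<T>; (\<Gamma> @ (y, T) # \<Delta> \<turnstile> IsType T') \<in> derived \<T>\<rbrakk>
    \<Longrightarrow> (\<Gamma> @ subst_ctx (Var(y := t2)) \<Delta> \<turnstile>
          TypeEq (subst (Var(y := t1)) T') (subst (Var(y := t2)) T')) \<in> derived \<T>"
| subst_term_eq:
    "\<lbrakk>(\<Gamma> \<turnstile> TermEq t1 t2 T) \<in> derived \<T>; (\<Gamma> @ (y, T) # \<Delta> \<turnstile> HasType t' T') \<in> derived \<T>\<rbrakk>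
    \<Longrightarrow> (\<Gamma> @ subst_ctx (Var(y := t2)) \<Delta> \<turnstile>
          TermEq (subst (Var(y := t1)) t') (subst (Var(y := t2)) t')
            (subst (Var(y := t2)) T')) \<in> derived \<T>"

definition introduces_type :: "'o \<Rightarrow> ('o + 's) judgement \<Rightarrow> bool" where
  "introduces_type A J \<longleftrightarrow> (\<exists>\<Gamma>. J = (\<Gamma> \<turnstile> IsType (App (Inl A) (map (Var \<circ> fst) \<Gamma>))))"

definition introduces_term :: "'s \<Rightarrow> ('o + 's) judgement \<Rightarrow> bool" where
  "introduces_term f J \<longleftrightarrow> (\<exists>\<Gamma> T. J = (\<Gamma> \<turnstile> HasType (App (Inr f) (map (Var \<circ> fst) \<Gamma>)) T))"

definition is_gat :: "('o, 's, 'z) gat_scheme \<Rightarrow> bool" where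
  "is_gat \<T> \<longleftrightarrow>
     basic \<T> \<subseteq> judgements (type_consts \<T> <+> term_consts \<T>) \<and>
     (\<forall>A\<in>type_consts \<T>. \<exists>!J. J \<in> basic \<T> \<and> introduces_type A J) \<and>
     (\<forall>f\<in>term_consts \<T>. \<exists>!J. J \<in> basic \<T> \<and> introduces_term f J) \<and>
     (\<forall>J\<in>basic \<T>. (\<exists>A\<in>type_consts \<T>. introduces_type A J) \<or>
        (\<exists>f\<in>term_consts \<T>. introduces_term f J) \<or> is_equality_judgement J) \<and>
     basic \<T> \<subseteq> derived \<T>"

text \<open>
  The relation \<open>\<equiv>\<close>. List positions start at 0, so position \<open>i\<close> below carries the \<open>(i+1)\<close>-st
  type, which lives in the context formed by the first \<open>i\<close> declarations.
\<close>

definition type_equiv ::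
    "('o, 's, 'z) gat_scheme \<Rightarrow> ('o + 's) ctx \<Rightarrow> ('o + 's) expr \<Rightarrow>
      ('o + 's) ctx \<Rightarrow> ('o + 's) expr \<Rightarrow> bool" where
  "type_equiv \<T> \<Gamma> S \<Delta> T \<longleftrightarrow>
     length \<Gamma> = length \<Delta> \<and>
     (\<forall>i\<le>length \<Gamma>.
        (take i \<Gamma> \<turnstile> TypeEq ((map snd \<Gamma> @ [S]) ! i)
           (subst (renaming (map fst (take i \<Gamma>)) (map fst (take i \<Delta>)))
             ((map snd \<Delta> @ [T]) ! i))) \<in> derived \<T>)"

fun judgement_equiv ::
    "('o, 's, 'z) gat_scheme \<Rightarrow> ('o + 's) judgement \<Rightarrow> ('o + 's) judgement \<Rightarrow> bool" where
  "judgement_equiv \<T> (\<Gamma> \<turnstile> IsType S) (\<Delta> \<turnstile> IsType T) = type_equiv \<T> \<Gamma> S \<Delta> T"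
| "judgement_equiv \<T> (\<Gamma> \<turnstile> HasType s S) (\<Delta> \<turnstile> HasType t T) =
     (type_equiv \<T> \<Gamma> S \<Delta> T \<and>
      (\<Gamma> \<turnstile> TermEq s (subst (renaming (map fst \<Gamma>) (map fst \<Delta>)) t) S) \<in> derived \<T>)"
| "judgement_equiv \<T> _ _ = False"

definition equiv_rel :: "('o, 's, 'z) gat_scheme \<Rightarrow> ('o + 's) judgement rel" where
  "equiv_rel \<T> = {(J, J'). J \<in> derived \<T> \<and> J' \<in> derived \<T> \<and> judgement_equiv \<T> J J'}"


section \<open>Type-and-term structures\<close>

text \<open>
  A presheaf on the category freely generated by the arrows \<open>n \<rightarrow> n+1\<close> and \<open>n \<rightarrow> n\<^sub>t\<close>, \<open>n \<ge> 1\<close>,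
  is a family of sets with an arbitrary choice of maps \<open>bd X n : X(n+1) \<rightarrow> X(n)\<close> and
  \<open>tbd X n : X(n\<^sub>t) \<rightarrow> X(n)\<close>. The values of the fields at \<open>n = 0\<close> carry no information.
\<close>

record ('a, 'b) type_term =
  ty :: "nat \<Rightarrow> 'a set"
  tm :: "nat \<Rightarrow> 'b set"
  bd :: "nat \<Rightarrow> 'a \<Rightarrow> 'a"
  tbd :: "nat \<Rightarrow> 'b \<Rightarrow> 'a"

definition presheaf :: "('a, 'b) type_term \<Rightarrow> bool" where
  "presheaf X \<longleftrightarrow>
     (\<forall>n\<ge>1. bd X n \<in> ty X (Suc n) \<rightarrow> ty X n \<and> tbd X n \<in> tm X n \<rightarrow> ty X n)"

definition Tm :: "('a, 'b) type_term \<Rightarrow> nat \<Rightarrow> 'a \<Rightarrow> 'b set" where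
  "Tm X n A = {a \<in> tm X n. tbd X n a = A}"

record ('a, 'b, 'c, 'd) tt_map =
  ty_map :: "nat \<Rightarrow> 'a \<Rightarrow> 'c"
  tm_map :: "nat \<Rightarrow> 'b \<Rightarrow> 'd"

text \<open>
  Natural transformations. The components are extensional, so that equal morphisms are equal
  as HOL values and the hom-sets have the right number of elements.
\<close>

definition hom ::
    "('a, 'b) type_term \<Rightarrow> ('c, 'd) type_term \<Rightarrow> ('a, 'b, 'c, 'd) tt_map set" where
  "hom X Y = {h.
     ty_map h \<in> (\<Pi>\<^sub>E n\<in>{1..}. ty X n \<rightarrow>\<^sub>E ty Y n) \<and>
     tm_map h \<in> (\<Pi>\<^sub>E n\<in>{1..}. tm X n \<rightarrow>\<^sub>E tm Y n) \<and>
     (\<forall>n\<ge>1. \<forall>A\<in>ty X (Suc n). ty_map h n (bd X n A) = bd Y n (ty_map h (Suc n) A)) \<and>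
     (\<forall>n\<ge>1. \<forall>a\<in>tm X n. ty_map h n (tbd X n a) = tbd Y n (tm_map h n a))}"

definition presheaf_iso ::
    "('a, 'b) type_term \<Rightarrow> ('c, 'd) type_term \<Rightarrow> ('a, 'b, 'c, 'd) tt_map \<Rightarrow> bool" where
  "presheaf_iso X Y h \<longleftrightarrow>
     presheaf X \<and> presheaf Y \<and> h \<in> hom X Y \<and>
     (\<forall>n\<ge>1. bij_betw (ty_map h n) (ty X n) (ty Y n) \<and>
             bij_betw (tm_map h n) (tm X n) (tm Y n))"

text \<open>Restriction of a morphism along the inclusion of a subpresheaf \<open>Z\<close> of its domain.\<close>

definition restrict_map ::
    "('a, 'b) type_term \<Rightarrow> ('a, 'b, 'c, 'd) tt_map \<Rightarrow> ('a, 'b, 'c, 'd) tt_map" where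
  "restrict_map Z h =
     \<lparr>ty_map = (\<lambda>n\<in>{1..}. restrict (ty_map h n) (ty Z n)),
      tm_map = (\<lambda>n\<in>{1..}. restrict (tm_map h n) (tm Z n))\<rparr>"


section \<open>The forgetful functor, the free theory and the substitution monad\<close>

text \<open>
  A boundary of an element is the class of the boundary of any representative. In the cases
  where \<open>bd\<close> and \<open>tbd\<close> matter, the list \<open>boundary J\<close> has exactly one element.
\<close>

definition forgetful ::
    "('o, 's, 'z) gat_scheme \<Rightarrow> (('o + 's) judgement set, ('o + 's) judgement set) type_term" where
  "forgetful \<T> =
     \<lparr>ty = (\<lambda>n. {J \<in> derived \<T>. is_type_judgement J \<and> degree J = n} // equiv_rel \<T>),
      tm = (\<lambda>n. {J \<in> derived \<T>. is_term_judgement J \<and> degree J = n} // equiv_rel \<T>),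
      bd = (\<lambda>n C. \<Union>J\<in>C. equiv_rel \<T> `` set (boundary J)),
      tbd = (\<lambda>n C. \<Union>J\<in>C. equiv_rel \<T> `` set (boundary J))\<rparr>"

text \<open>For \<open>A \<in> X(n)\<close> and \<open>1 \<le> i \<le> n\<close>, \<open>ancestor X n i A\<close> is the \<open>(n-i)\<close>-fold boundary of \<open>A\<close>.\<close>

primrec iterated_bd :: "('a, 'b) type_term \<Rightarrow> nat \<Rightarrow> nat \<Rightarrow> 'a \<Rightarrow> 'a" where
  "iterated_bd X 0 n A = A"
| "iterated_bd X (Suc k) n A = iterated_bd X k (n - 1) (bd X (n - 1) A)"

definition ancestor :: "('a, 'b) type_term \<Rightarrow> nat \<Rightarrow> nat \<Rightarrow> 'a \<Rightarrow> 'a" where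
  "ancestor X n i A = iterated_bd X (n - i) n A"

text \<open>
  The sets \<open>X(n)\<close> for different \<open>n\<close> may overlap as sets of HOL values, so the constants of the
  free theory are tagged with their degree. The variable \<open>x\<^sub>i\<close> is the natural number \<open>i\<close>.
\<close>

definition generic_ctx ::
    "('a, 'b) type_term \<Rightarrow> nat \<Rightarrow> 'a \<Rightarrow> (nat \<times> 'a + nat \<times> 'b) ctx" where
  "generic_ctx X n A = map (\<lambda>i. (i, App (Inl (i, ancestor X n i A)) (map Var [1..<i]))) [1..<n]"

definition generic_type :: "nat \<Rightarrow> 'a \<Rightarrow> (nat \<times> 'a + nat \<times> 'b) expr" where
  "generic_type n A = App (Inl (n, A)) (map Var [1..<n])"

definition generic_term :: "nat \<Rightarrow> 'b \<Rightarrow> (nat \<times> 'a + nat \<times> 'b) expr" where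
  "generic_term n a = App (Inr (n, a)) (map Var [1..<n])"

definition free_gat :: "('a, 'b) type_term \<Rightarrow> (nat \<times> 'a, nat \<times> 'b) gat" where
  "free_gat X =
     \<lparr>type_consts = Sigma {1..} (ty X),
      term_consts = Sigma {1..} (tm X),
      basic =
        {generic_ctx X n A \<turnstile> IsType (generic_type n A) | n A. 1 \<le> n \<and> A \<in> ty X n} \<union>
        {generic_ctx X n A \<turnstile> HasType (generic_term n a) (generic_type n A) | n A a.
           1 \<le> n \<and> A \<in> ty X n \<and> a \<in> Tm X n A}\<rparr>"

lemma ancestor_self [simp]: "ancestor X n n A = A"
  by (simp add: ancestor_def)

lemma ancestor_Suc: "i \<le> m \<Longrightarrow> ancestor X (Suc m) i A = ancestor X m i (bd X m A)"
  by (simp add: ancestor_def Suc_diff_le)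

lemma ancestor_in_ty:
  assumes "presheaf X" "1 \<le> i" "i \<le> n" "A \<in> ty X n"
  shows "ancestor X n i A \<in> ty X i"
  using assms(3,4)
proof (induction n arbitrary: A rule: dec_induct)
  case base
  then show ?case by simp
next
  case (step m)
  have "bd X m A \<in> ty X m"
    using assms(1,2) step.hyps(1) step.prems le_trans unfolding presheaf_def by blast
  then show ?case
    using step by (simp add: ancestor_Suc)
qed

lemma generic_ctx_Suc:
  assumes "1 \<le> m"
  shows "generic_ctx X (Suc m) A =
    generic_ctx X m (bd X m A) @ [(m, generic_type m (bd X m A))]"
  using assms by (auto simp: generic_ctx_def generic_type_def ancestor_Suc)

lemma generic_vars: "map fst (generic_ctx X n A) = [1..<n]"
  by (simp add: generic_ctx_def comp_def)

lemma generic_args: "map (Var \<circ> fst) (generic_ctx X n A) = map Var [1..<n]"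
  by (simp add: generic_ctx_def comp_def)

lemma generic_type_derived:
  assumes "presheaf X" "1 \<le> n" "A \<in> ty X n"
  shows "(generic_ctx X n A \<turnstile> IsType (generic_type n A)) \<in> derived (free_gat X)"
  using assms(2,3)
proof (induction n arbitrary: A rule: dec_induct)
  case base
  then show ?case
    by - (rule derived.basic, (auto simp: free_gat_def generic_ctx_def)+)
next
  case (step m)
  have "bd X m A \<in> ty X m"
    using assms(1) step.hyps step.prems unfolding presheaf_def by blast
  then have "(generic_ctx X m (bd X m A) \<turnstile> IsType (generic_type m (bd X m A)))
      \<in> derived (free_gat X)"
    by (rule step.IH)
  moreover have "(generic_ctx X (Suc m) A \<turnstile> IsType (generic_type (Suc m) A))
      \<in> basic (free_gat X)"
    using step.hyps step.prems by (fastforce simp: free_gat_def)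
  ultimately show ?case
    using step.hyps by - (rule derived.basic, (simp_all add: generic_ctx_Suc)+)
qed

lemma generic_symbols:
  assumes "presheaf X" "1 \<le> n" "A \<in> ty X n"
  shows "judgement_symbols (generic_ctx X n A \<turnstile> IsType (generic_type n A))
           \<subseteq> type_consts (free_gat X) <+> term_consts (free_gat X)"
  using assms
  by (auto simp: generic_ctx_def generic_type_def free_gat_def intro!: InlI ancestor_in_ty)

lemma is_gat_free_gat:
  assumes X: "presheaf X"
  shows "is_gat (free_gat X)"
  unfolding is_gat_def
proof (intro conjI ballI subsetI)
  fix J assume "J \<in> basic (free_gat X)"
  then consider (ty) n A where "1 \<le> n" "A \<in> ty X n"
      "J = (generic_ctx X n A \<turnstile> IsType (generic_type n A))"
    | (tm) n A a where "1 \<le> n" "A \<in> ty X n" "a \<in> Tm X n A"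
      "J = (generic_ctx X n A \<turnstile> HasType (generic_term n a) (generic_type n A))"
    by (auto simp: free_gat_def)
  note J = this
  show "J \<in> judgements (type_consts (free_gat X) <+> term_consts (free_gat X))"
    using J
  proof cases
    case ty
    then show ?thesis
      using generic_symbols[OF X ty(1,2)] by (simp add: judgements_def generic_vars)
  next
    case tm
    then have "symbols (generic_term n a :: (nat \<times> 'a + nat \<times> 'b) expr)
        \<subseteq> type_consts (free_gat X) <+> term_consts (free_gat X)"
      by (auto simp: generic_term_def free_gat_def Tm_def)
    then show ?thesis
      using generic_symbols[OF X tm(1,2)] tm by (simp add: judgements_def generic_vars)
  qed
  show "(\<exists>A\<in>type_consts (free_gat X). introduces_type A J) \<or>
        (\<exists>f\<in>term_consts (free_gat X). introduces_term f J) \<or> is_equality_judgement J"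
    using J
  proof cases
    case ty
    then have "introduces_type (n, A) J"
      by (simp add: introduces_type_def generic_type_def generic_args)
    then show ?thesis
      using ty by (auto simp: free_gat_def)
  next
    case tm
    then have "introduces_term (n, a) J"
      by (simp add: introduces_term_def generic_term_def generic_args)
    then show ?thesis
      using tm by (auto simp: free_gat_def Tm_def)
  qed
  show "J \<in> derived (free_gat X)"
    using J
  proof cases
    case ty
    then show ?thesis
      using generic_type_derived[OF X] by simp
  next
    case tm
    then show ?thesis
      using generic_type_derived[OF X tm(1,2)] by - (rule derived.basic, (auto simp: free_gat_def)+)
  qed
next
  fix c assume "c \<in> type_consts (free_gat X)"
  then obtain n A where c: "c = (n, A)" "1 \<le> n" "A \<in> ty X n"
    by (auto simp: free_gat_def)
  show "\<exists>!J. J \<in> basic (free_gat X) \<and> introduces_type c J"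
  proof (rule ex1I[where a = "generic_ctx X n A \<turnstile> IsType (generic_type n A)"])
    show "(generic_ctx X n A \<turnstile> IsType (generic_type n A)) \<in> basic (free_gat X) \<and>
        introduces_type c (generic_ctx X n A \<turnstile> IsType (generic_type n A))"
      using c by (auto simp: free_gat_def introduces_type_def generic_type_def generic_args)
  qed (use c in \<open>auto simp: free_gat_def introduces_type_def generic_type_def\<close>)
next
  fix c assume "c \<in> term_consts (free_gat X)"
  then obtain n a where c: "c = (n, a)" "1 \<le> n" "a \<in> tm X n"
    by (auto simp: free_gat_def)
  define A where "A = tbd X n a"
  have A: "A \<in> ty X n" "a \<in> Tm X n A"
    using X c by (auto simp: presheaf_def A_def Tm_def)
  let ?J = "generic_ctx X n A \<turnstile> HasType (generic_term n a) (generic_type n A)"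
  show "\<exists>!J. J \<in> basic (free_gat X) \<and> introduces_term c J"
  proof (rule ex1I[where a = ?J])
    show "?J \<in> basic (free_gat X) \<and> introduces_term c ?J"
      using c A by (auto simp: free_gat_def introduces_term_def generic_term_def generic_args)
  qed (use c in \<open>auto simp: free_gat_def introduces_term_def generic_term_def A_def Tm_def\<close>)
qed

text \<open>The value at \<open>X\<close> of the endofunctor underlying the substitution monad.\<close>

definition substitution_monad ::
    "('a, 'b) type_term \<Rightarrow>
      ((nat \<times> 'a + nat \<times> 'b) judgement set, (nat \<times> 'a + nat \<times> 'b) judgement set) type_term" where
  "substitution_monad X = forgetful (free_gat X)"


section \<open>Inc-lists and the identification\<close>

definition Inc :: "nat \<Rightarrow> (nat \<Rightarrow> nat) set" where
  "Inc n = {\<alpha> \<in> extensional {0..n}. strict_mono_on {0..n} \<alpha> \<and> \<alpha> 0 = 0}"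

definition inc_bd :: "nat \<Rightarrow> (nat \<Rightarrow> nat) \<Rightarrow> nat \<Rightarrow> nat" where
  "inc_bd n \<alpha> = restrict \<alpha> {0..n}"

text \<open>The presheaf \<open>[\<alpha>]\<close> for \<open>\<alpha> \<in> Inc n\<close>; both elements \<open>i\<close> and \<open>i\<^sub>t\<close> are encoded as \<open>i\<close>.\<close>

definition inc_presheaf :: "nat \<Rightarrow> (nat \<Rightarrow> nat) \<Rightarrow> (nat, nat) type_term" where
  "inc_presheaf n \<alpha> =
     \<lparr>ty = (\<lambda>i. if i \<le> \<alpha> n then {i} else {}),
      tm = (\<lambda>i. if i \<le> \<alpha> n \<and> i \<notin> \<alpha> ` {0..n} then {i} else {}),
      bd = (\<lambda>i _. i),
      tbd = (\<lambda>i _. i)\<rparr>"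

text \<open>
  The claimed description of \<open>SX\<close>. Its set of term-elements of degree \<open>n\<close> is the disjoint union
  of the sets \<open>Tm X (\<alpha> n) (h(\<alpha>(n)))\<close> over the type-elements \<open>(\<alpha>, h)\<close> of degree \<open>n\<close>.
\<close>

definition inc_structure ::
    "('a, 'b) type_term \<Rightarrow>
      ((nat \<Rightarrow> nat) \<times> (nat, nat, 'a, 'b) tt_map,
       ((nat \<Rightarrow> nat) \<times> (nat, nat, 'a, 'b) tt_map) \<times> 'b) type_term" where
  "inc_structure X =
     \<lparr>ty = (\<lambda>n. SIGMA \<alpha>:Inc n. hom (inc_presheaf n \<alpha>) X),
      tm = (\<lambda>n. SIGMA (\<alpha>, h):(SIGMA \<alpha>:Inc n. hom (inc_presheaf n \<alpha>) X).
              Tm X (\<alpha> n) (ty_map h (\<alpha> n) (\<alpha> n))),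
      bd = (\<lambda>n (\<alpha>, h). (inc_bd n \<alpha>, restrict_map (inc_presheaf n (inc_bd n \<alpha>)) h)),
      tbd = (\<lambda>n. fst)\<rparr>"

text \<open>The expressions \<open>e\<^sub>j\<close>, \<open>1 \<le> j \<le> \<alpha>(n)\<close>, attached to \<open>(\<alpha>, h)\<close>.\<close>

fun arg_expr ::
    "nat \<Rightarrow> (nat \<Rightarrow> nat) \<Rightarrow> (nat, nat, 'a, 'b) tt_map \<Rightarrow> nat \<Rightarrow>
      (nat \<times> 'a + nat \<times> 'b) expr" where
  "arg_expr n \<alpha> h j =
     (if j \<in> \<alpha> ` {1..n} then Var (the_inv_into {1..n} \<alpha> j)
      else App (Inr (j, tm_map h j j)) (map (\<lambda>i. arg_expr n \<alpha> h i) [1..<j]))"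

declare arg_expr.simps [simp del]

definition ident_type ::
    "nat \<Rightarrow> (nat \<Rightarrow> nat) \<Rightarrow> (nat, nat, 'a, 'b) tt_map \<Rightarrow> nat \<Rightarrow>
      (nat \<times> 'a + nat \<times> 'b) expr" where
  "ident_type n \<alpha> h i =
     App (Inl (\<alpha> i, ty_map h (\<alpha> i) (\<alpha> i))) (map (arg_expr n \<alpha> h) [1..<\<alpha> i])"

definition ident_ctx ::
    "nat \<Rightarrow> (nat \<Rightarrow> nat) \<Rightarrow> (nat, nat, 'a, 'b) tt_map \<Rightarrow>
      (nat \<times> 'a + nat \<times> 'b) ctx" where
  "ident_ctx n \<alpha> h = map (\<lambda>i. (i, ident_type n \<alpha> h i)) [1..<n]"

definition ident_type_judgement ::
    "nat \<Rightarrow> (nat \<Rightarrow> nat) \<Rightarrow> (nat, nat, 'a, 'b) tt_map \<Rightarrow>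
      (nat \<times> 'a + nat \<times> 'b) judgement" where
  "ident_type_judgement n \<alpha> h = (ident_ctx n \<alpha> h \<turnstile> IsType (ident_type n \<alpha> h n))"

definition ident_term_judgement ::
    "nat \<Rightarrow> (nat \<Rightarrow> nat) \<Rightarrow> (nat, nat, 'a, 'b) tt_map \<Rightarrow> 'b \<Rightarrow>
      (nat \<times> 'a + nat \<times> 'b) judgement" where
  "ident_term_judgement n \<alpha> h a =
     (ident_ctx n \<alpha> h \<turnstile>
        HasType (App (Inr (\<alpha> n, a)) (map (arg_expr n \<alpha> h) [1..<\<alpha> n])) (ident_type n \<alpha> h n))"

definition identification ::
    "('a, 'b) type_term \<Rightarrow>
      ((nat \<Rightarrow> nat) \<times> (nat, nat, 'a, 'b) tt_map,
       ((nat \<Rightarrow> nat) \<times> (nat, nat, 'a, 'b) tt_map) \<times> 'b,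
       (nat \<times> 'a + nat \<times> 'b) judgement set,
       (nat \<times> 'a + nat \<times> 'b) judgement set) tt_map" where
  "identification X =
     \<lparr>ty_map = (\<lambda>n\<in>{1..}. \<lambda>(\<alpha>, h)\<in>ty (inc_structure X) n.
        equiv_rel (free_gat X) `` {ident_type_judgement n \<alpha> h}),
      tm_map = (\<lambda>n\<in>{1..}. \<lambda>((\<alpha>, h), a)\<in>tm (inc_structure X) n.
        equiv_rel (free_gat X) `` {ident_term_judgement n \<alpha> h a})\<rparr>"

end

theory Submission
  imports Defs
begin

text \<open>
  In the free theory on \<open>X\<close> there are no equality axioms, so the equality rules only ever relate an
  expression to itself. There is also no weakening rule and no rule that makes a declared variable
  a term, so every derived type or term judgement arises from the generic judgement of some
  \<open>A \<in> X(N)\<close>, or of some \<open>a \<in> Tm(A)\<close>, by substituting terms for variables and permuting the variables.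

  The constant \<open>A\<close> has one argument slot for each \<open>j < N\<close>, whose declared type is the ancestor
  \<open>A\<^sub>j\<close> of \<open>A\<close>. Substituting a term for the variable in slot \<open>M\<close> changes the expressions only through
  this slot: the head constant of the term must be some \<open>a \<in> Tm(A\<^sub>M)\<close>, and its arguments are already
  the contents of the slots below \<open>M\<close>, because the contexts of the two premises agree. A derived
  type or term judgement is thus the same as an \<open>A \<in> X(N)\<close> together with a slot assignment \<open>p\<close>, which puts into
  each slot \<open>j < N\<close> either a variable, different ones in different slots, or an element of
  \<open>Tm(A\<^sub>j)\<close> (and, for term judgements, an element of \<open>Tm(A)\<close>). The theorems
  \<open>derived_imp_slot_judgement\<close> and \<open>slot_judgement_derived\<close> are the two halves of this statement.

  Since derivable equality is identity, \<open>\<equiv>\<close> only identifies judgements that differ by a permutation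
  of the variables (\<open>equiv_rel_iff_permute\<close>). A slot assignment up to renaming of variables is
  the set of slots that hold variables together with the elements in the other slots. With \<open>N\<close> added
  to it, this set is the image of \<open>{1..n}\<close> under a unique inc-list \<open>\<alpha>\<close>, and \<open>A\<close> with the elements
  in the slots outside the image is a morphism \<open>h\<close> from \<open>[\<alpha>]\<close> to \<open>X\<close>. The judgement attached to
  \<open>(\<alpha>, h)\<close> is the member of the orbit whose context declares \<open>x\<^sub>1, \<dots>, x\<^sub>n\<^sub>-\<^sub>1\<close> in this order; it
  exists by \<open>slots_normal_form\<close>, and it determines \<open>\<alpha>\<close> and \<open>h\<close> by \<open>ident_type_judgement_inject\<close>.
  Deleting the last declaration of this judgement restricts \<open>\<alpha>\<close> and \<open>h\<close> (\<open>boundary_ident_type\<close>),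
  which is compatibility with boundaries.
\<close>

section \<open>Variables and permutations\<close>

primrec vars :: "'w expr \<Rightarrow> var set" where
  "vars (Var x) = {x}"
| "vars (App w es) = \<Union> (set (map vars es))"

lemma subst_cong_vars: "(\<And>x. x \<in> vars e \<Longrightarrow> \<theta> x = \<eta> x) \<Longrightarrow> subst \<theta> e = subst \<eta> e"
  by (induction e) auto

lemma subst_subst: "subst \<theta> (subst \<eta> e) = subst (\<lambda>x. subst \<theta> (\<eta> x)) e"
  by (induction e) auto

lemma subst_Var [simp]: "subst Var e = e"
  by (induction e) (auto simp: map_idI)

definition permute :: "(var \<Rightarrow> var) \<Rightarrow> 'w judgement \<Rightarrow> 'w judgement" where
  "permute \<sigma> J = (permute_ctx \<sigma> (ctx_of J) \<turnstile> subst_rhs (Var \<circ> \<sigma>) (rhs_of J))"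

lemma subst_rhs_subst_rhs: "subst_rhs \<theta> (subst_rhs \<eta> R) = subst_rhs (\<lambda>x. subst \<theta> (\<eta> x)) R"
  by (cases R) (auto simp: subst_subst)

lemma permute_permute: "permute \<sigma> (permute \<tau> J) = permute (\<sigma> \<circ> \<tau>) J"
  by (auto simp: permute_def permute_ctx_def subst_subst subst_rhs_subst_rhs comp_def)

lemma permute_id: "permute id J = J"
proof -
  have "subst_rhs Var R = R" for R :: "'a rhs"
    by (cases R) auto
  then show ?thesis
    by (cases J) (auto simp: permute_def permute_ctx_def comp_def map_idI)
qed

lemma permute_inv: "bij \<sigma> \<Longrightarrow> J = permute \<sigma> K \<Longrightarrow> K = permute (inv \<sigma>) J"
  by (simp add: permute_permute permute_id bij_is_inj)

text \<open>
  The domain \<open>A\<close> and the range \<open>f ` A\<close> have the same number of elements, so \<open>f\<close> can be completed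
  to a permutation of the finite set \<open>A \<union> f ` A\<close>. The \<open>\<alpha>\<close>-rule speaks of permutations of all
  variables only, and this lemma turns a renaming of the variables of a judgement into one of them.
\<close>

lemma ex_bij_extending:
  assumes "finite A" "inj_on f A"
  obtains \<sigma> :: "'a \<Rightarrow> 'a" where "bij \<sigma>" "\<And>x. x \<in> A \<Longrightarrow> \<sigma> x = f x"
proof -
  define B where "B = A \<union> f ` A"
  have "card (B - A) = card (B - f ` A)"
    using assms by (simp add: B_def card_Diff_subset card_image)
  then obtain g where g: "bij_betw g (B - A) (B - f ` A)"
    using assms by (metis B_def finite_Diff finite_UnI finite_imageI finite_same_card_bij)
  define \<sigma> where "\<sigma> x = (if x \<in> A then f x else if x \<in> B then g x else x)" for x
  have "bij_betw \<sigma> A (f ` A)"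
    using assms(2) by (auto simp: bij_betw_def \<sigma>_def inj_on_def)
  moreover have "bij_betw \<sigma> (B - A) (B - f ` A)"
    using g by (rule bij_betw_cong[THEN iffD1, rotated]) (auto simp: \<sigma>_def)
  moreover have "bij_betw \<sigma> (- B) (- B)"
    by (rule bij_betw_cong[THEN iffD1, OF _ bij_betw_id]) (auto simp: \<sigma>_def B_def)
  ultimately have "bij_betw \<sigma> (A \<union> (B - A) \<union> - B) (f ` A \<union> (B - f ` A) \<union> - B)"
    by (intro bij_betw_combine) (auto simp: B_def)
  moreover have "A \<union> (B - A) \<union> - B = UNIV" "f ` A \<union> (B - f ` A) \<union> - B = UNIV"
    by (auto simp: B_def)
  ultimately have "bij \<sigma>"
    by simp
  then show thesis
    using that by (simp add: \<sigma>_def)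
qed


section \<open>Slot assignments\<close>

text \<open>
  A slot assignment \<open>p\<close> puts a variable (\<open>Inl\<close>) or a term-element (\<open>Inr\<close>) into each slot. Slot \<open>j\<close>
  is read as an argument of degree \<open>j\<close>, so a term-element in it is applied to the contents of the
  slots below \<open>j\<close>. For the assignment of a pair \<open>(\<alpha>, h)\<close> these are the expressions \<open>e\<^sub>j\<close>.
\<close>

fun slot_expr :: "(nat \<Rightarrow> var + 'b) \<Rightarrow> nat \<Rightarrow> (nat \<times> 'a + nat \<times> 'b) expr" where
  "slot_expr p j =
     (case p j of Inl x \<Rightarrow> Var x
      | Inr b \<Rightarrow> App (Inr (j, b)) (map (\<lambda>i. slot_expr p i) [1..<j]))"

declare slot_expr.simps [simp del]

definition slot_term :: "(nat \<Rightarrow> var + 'b) \<Rightarrow> nat \<Rightarrow> 'b \<Rightarrow> (nat \<times> 'a + nat \<times> 'b) expr" where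
  "slot_term p N a = App (Inr (N, a)) (map (slot_expr p) [1..<N])"

definition slot_type :: "(nat \<Rightarrow> var + 'b) \<Rightarrow> nat \<Rightarrow> 'a \<Rightarrow> (nat \<times> 'a + nat \<times> 'b) expr" where
  "slot_type p N A = App (Inl (N, A)) (map (slot_expr p) [1..<N])"

definition slot_decl ::
    "('a, 'b) type_term \<Rightarrow> (nat \<Rightarrow> var + 'b) \<Rightarrow> nat \<Rightarrow> 'a \<Rightarrow> nat \<Rightarrow>
      var \<times> (nat \<times> 'a + nat \<times> 'b) expr" where
  "slot_decl X p N A j = (projl (p j), slot_type p j (ancestor X N j A))"

definition var_slots :: "(nat \<Rightarrow> var + 'b) \<Rightarrow> nat \<Rightarrow> nat list" where
  "var_slots p N = filter (\<lambda>j. isl (p j)) [1..<N]"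

definition slot_ctx ::
    "('a, 'b) type_term \<Rightarrow> (nat \<Rightarrow> var + 'b) \<Rightarrow> nat \<Rightarrow> 'a \<Rightarrow> (nat \<times> 'a + nat \<times> 'b) ctx" where
  "slot_ctx X p N A = map (slot_decl X p N A) (var_slots p N)"

text \<open>
  Equality judgements appear here with two identical sides only, so that membership in this set
  already says that derivable equality is identity.
\<close>

definition slot_rhs ::
    "('a, 'b) type_term \<Rightarrow> (nat \<Rightarrow> var + 'b) \<Rightarrow> nat \<Rightarrow> 'a \<Rightarrow> (nat \<times> 'a + nat \<times> 'b) rhs set" where
  "slot_rhs X p N A =
     {IsType (slot_type p N A), TypeEq (slot_type p N A) (slot_type p N A)} \<union>
     (\<Union>a\<in>Tm X N A. {HasType (slot_term p N a) (slot_type p N A),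
                    TermEq (slot_term p N a) (slot_term p N a) (slot_type p N A)})"

definition valid_slots ::
    "('a, 'b) type_term \<Rightarrow> (nat \<Rightarrow> var + 'b) \<Rightarrow> nat \<Rightarrow> 'a \<Rightarrow> bool" where
  "valid_slots X p N A \<longleftrightarrow>
     1 \<le> N \<and> A \<in> ty X N \<and>
     (\<forall>i\<in>{1..<N}. \<forall>j\<in>{1..<N}. isl (p i) \<and> p i = p j \<longrightarrow> i = j) \<and>
     (\<forall>j\<in>{1..<N}. \<forall>b. p j = Inr b \<longrightarrow> b \<in> Tm X j (ancestor X N j A))"

definition slot_judgement ::
    "('a, 'b) type_term \<Rightarrow> (nat \<times> 'a + nat \<times> 'b) judgement \<Rightarrow> bool" where
  "slot_judgement X J \<longleftrightarrow>
     (\<exists>p N A. valid_slots X p N A \<and> ctx_of J = slot_ctx X p N A \<and> rhs_of J \<in> slot_rhs X p N A)"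

lemma ancestor_ancestor:
  assumes "j \<le> M" "M \<le> N"
  shows "ancestor X M j (ancestor X N M A) = ancestor X N j A"
  using assms(2)
  by (induction N arbitrary: A rule: dec_induct) (use assms(1) in \<open>auto simp: ancestor_Suc\<close>)

lemma slot_expr_Inl: "p j = Inl x \<Longrightarrow> slot_expr p j = Var x"
  by (simp add: slot_expr.simps)

lemma slot_expr_Inr: "p j = Inr b \<Longrightarrow> slot_expr p j = slot_term p j b"
  by (simp add: slot_expr.simps[of p j] slot_term_def)

text \<open>
  All substitutions and renamings below act on slot expressions by this lemma: it suffices that
  \<open>\<theta>\<close> sends the variables in the slots to the new contents and that the term-elements stay.
\<close>

lemma subst_slot_expr:
  assumes "\<And>i x. 1 \<le> i \<Longrightarrow> i \<le> j \<Longrightarrow> p i = Inl x \<Longrightarrow> \<theta> x = slot_expr q i"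
    and "\<And>i b. 1 \<le> i \<Longrightarrow> i \<le> j \<Longrightarrow> p i = Inr b \<Longrightarrow> q i = Inr b"
    and "1 \<le> j"
  shows "subst \<theta> (slot_expr p j) = slot_expr q j"
  using assms
proof (induction j rule: less_induct)
  case (less j)
  show ?case
  proof (cases "p j")
    case (Inl x)
    then show ?thesis
      using less.prems by (simp add: slot_expr_Inl)
  next
    case (Inr b)
    moreover have "q j = Inr b"
      using Inr less.prems(2,3) by blast
    moreover have "subst \<theta> (slot_expr p i) = slot_expr q i" if "i \<in> set [1..<j]" for i
      using that by (intro less.IH less.prems(1,2)) auto
    ultimately show ?thesis
      by (simp add: slot_expr_Inr slot_term_def)
  qed
qed

lemma slot_expr_cong:
  fixes p q :: "nat \<Rightarrow> var + 'b"
  assumes "\<And>i. 1 \<le> i \<Longrightarrow> i \<le> j \<Longrightarrow> p i = q i" "1 \<le> j"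
  shows "slot_expr p j = slot_expr q j"
proof -
  have "subst Var (slot_expr p j) = slot_expr q j"
  proof (rule subst_slot_expr)
    fix i x assume "1 \<le> i" "i \<le> j" "p i = Inl x"
    then show "Var x = slot_expr q i"
      using assms(1)[of i] by (intro slot_expr_Inl[symmetric]) simp
  next
    fix i b assume "1 \<le> i" "i \<le> j" "p i = Inr b"
    then show "q i = Inr b"
      using assms(1)[of i] by simp
  qed (rule assms(2))
  then show ?thesis
    by simp
qed

lemma map_slot_expr_cong:
  assumes "\<And>i. 1 \<le> i \<Longrightarrow> i < N \<Longrightarrow> p i = q i"
  shows "map (slot_expr p) [1..<N] = map (slot_expr q) [1..<N]"
proof (rule map_cong[OF refl])
  fix j assume "j \<in> set [1..<N]"
  then show "slot_expr p j = slot_expr q j"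
    by (intro slot_expr_cong assms) simp_all
qed

lemma slot_type_cong:
  "(\<And>i. 1 \<le> i \<Longrightarrow> i < N \<Longrightarrow> p i = q i) \<Longrightarrow> slot_type p N A = slot_type q N A"
  unfolding slot_type_def using map_slot_expr_cong[of N p q] by simp

lemma slot_term_cong:
  "(\<And>i. 1 \<le> i \<Longrightarrow> i < N \<Longrightarrow> p i = q i) \<Longrightarrow> slot_term p N a = slot_term q N a"
  unfolding slot_term_def using map_slot_expr_cong[of N p q] by simp

lemma slot_ctx_cong:
  assumes "\<And>i. 1 \<le> i \<Longrightarrow> i < N \<Longrightarrow> p i = q i"
  shows "slot_ctx X p N A = slot_ctx X q N A"
proof -
  have "var_slots p N = var_slots q N"
    using assms by (auto simp: var_slots_def intro!: filter_cong)
  moreover have "slot_decl X p N A j = slot_decl X q N A j" if "j \<in> set (var_slots q N)" for j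
    using that assms by (auto simp: slot_decl_def var_slots_def intro!: slot_type_cong)
  ultimately show ?thesis
    by (simp add: slot_ctx_def)
qed

lemma set_var_slots: "j \<in> set (var_slots p N) \<longleftrightarrow> 1 \<le> j \<and> j < N \<and> isl (p j)"
  by (auto simp: var_slots_def)

lemma distinct_var_slots: "distinct (var_slots p N)"
  by (simp add: var_slots_def)

lemma upt_split: "1 \<le> M \<Longrightarrow> M < N \<Longrightarrow> [1..<N] = [1..<M] @ M # [Suc M..<N]"
  using upt_add_eq_append[of 1 M "N - M"] by (simp add: upt_conv_Cons)

lemma var_slots_split:
  assumes "1 \<le> M" "M < N" "isl (p M)"
  shows "var_slots p N = var_slots p M @ M # filter (\<lambda>j. isl (p j)) [Suc M..<N]"
  using assms(3) unfolding var_slots_def upt_split[OF assms(1,2)] by simp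

lemma slot_decl_ancestor:
  "j \<le> M \<Longrightarrow> M \<le> N \<Longrightarrow> slot_decl X p M (ancestor X N M A) j = slot_decl X p N A j"
  by (simp add: slot_decl_def ancestor_ancestor)

lemma slot_ctx_split:
  assumes "1 \<le> M" "M < N" "p M = Inl y"
  shows "slot_ctx X p N A =
     slot_ctx X p M (ancestor X N M A) @ (y, slot_type p M (ancestor X N M A)) #
       map (slot_decl X p N A) (filter (\<lambda>j. isl (p j)) [Suc M..<N])"
proof -
  have "map (slot_decl X p M (ancestor X N M A)) (var_slots p M)
      = map (slot_decl X p N A) (var_slots p M)"
    using assms by (auto simp: set_var_slots slot_decl_ancestor)
  then show ?thesis
    using assms by (simp add: slot_ctx_def var_slots_split) (simp add: slot_decl_def)
qed

text \<open>
  In a decomposition of a context at one of its declarations, the declared variable fills some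
  slot \<open>M\<close>, and what stands before it is the context of the slots below \<open>M\<close>. This matches the
  premises of the substitution rules with slots.
\<close>

lemma slot_ctx_splitE:
  assumes "slot_ctx X p N A = \<Gamma> @ (y, T) # \<Delta>"
  obtains M where "1 \<le> M" "M < N" "p M = Inl y" "\<Gamma> = slot_ctx X p M (ancestor X N M A)"
    "T = slot_type p M (ancestor X N M A)"
    "\<Delta> = map (slot_decl X p N A) (filter (\<lambda>j. isl (p j)) [Suc M..<N])"
proof -
  obtain us M vs where *: "var_slots p N = us @ M # vs" "\<Gamma> = map (slot_decl X p N A) us"
      "(y, T) = slot_decl X p N A M" "\<Delta> = map (slot_decl X p N A) vs"
    using assms unfolding slot_ctx_def by (auto simp: map_eq_append_conv map_eq_Cons_conv)
  have M: "1 \<le> M" "M < N" "isl (p M)"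
    using *(1) set_var_slots[of M p N] by auto
  then have y: "p M = Inl y"
    using *(3) by (auto simp: slot_decl_def isl_def)
  have "M \<notin> set us" "M \<notin> set vs"
    using distinct_var_slots[of p N] *(1) by auto
  then have "us = var_slots p M" "vs = filter (\<lambda>j. isl (p j)) [Suc M..<N]"
    using var_slots_split[of M N p] M *(1) by (simp_all add: append_Cons_eq_iff)
  then have "length \<Gamma> = length (slot_ctx X p M (ancestor X N M A))"
    using * by (simp add: slot_ctx_def)
  then show thesis
    using that[OF M(1,2) y] assms slot_ctx_split[where p = p, OF M(1,2) y, of X A] by simp
qed

lemma valid_slots_ancestor:
  assumes "presheaf X" "valid_slots X p N A" "1 \<le> M" "M \<le> N"
  shows "valid_slots X p M (ancestor X N M A)"
  using assms ancestor_in_ty[OF assms(1), of M N A]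
  by (auto simp: valid_slots_def ancestor_ancestor)

lemma subst_slot_type:
  "(\<And>j. 1 \<le> j \<Longrightarrow> j < N \<Longrightarrow> subst \<theta> (slot_expr p j) = slot_expr q j) \<Longrightarrow>
    subst \<theta> (slot_type p N A) = slot_type q N A"
  by (simp add: slot_type_def)

lemma subst_slot_term:
  "(\<And>j. 1 \<le> j \<Longrightarrow> j < N \<Longrightarrow> subst \<theta> (slot_expr p j) = slot_expr q j) \<Longrightarrow>
    subst \<theta> (slot_term p N a) = slot_term q N a"
  by (simp add: slot_term_def)

lemma image_slot_rhs:
  fixes p q :: "nat \<Rightarrow> var + 'b" and A :: 'a
  assumes "\<And>j. 1 \<le> j \<Longrightarrow> j < N \<Longrightarrow>
    subst \<theta> (slot_expr p j) = (slot_expr q j :: (nat \<times> 'a + nat \<times> 'b) expr)"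
  shows "subst_rhs \<theta> ` slot_rhs X p N A = slot_rhs X q N A"
proof -
  have "subst \<theta> (slot_type p N A) = slot_type q N A"
    "subst \<theta> (slot_term p N a) = (slot_term q N a :: (nat \<times> 'a + nat \<times> 'b) expr)" for a
    by (intro subst_slot_type subst_slot_term assms; assumption)+
  then show ?thesis
    unfolding slot_rhs_def by (simp add: image_Un image_UN)
qed

lemma subst_slot_rhs:
  fixes p q :: "nat \<Rightarrow> var + 'b" and A :: 'a
  assumes "\<And>j. 1 \<le> j \<Longrightarrow> j < N \<Longrightarrow>
    subst \<theta> (slot_expr p j) = (slot_expr q j :: (nat \<times> 'a + nat \<times> 'b) expr)"
    and "R \<in> slot_rhs X p N A"
  shows "subst_rhs \<theta> R \<in> slot_rhs X q N A"
  using image_slot_rhs[OF assms(1)] assms(2) by blast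

text \<open>
  Substituting for the variable in slot \<open>M\<close> has the same effect as refilling this slot: the variable
  occurs in no other slot, and the slots below \<open>M\<close>, hence the arguments of the substituted term,
  do not depend on the content of slot \<open>M\<close>.
\<close>

lemma subst_fill_slot:
  fixes X :: "('a, 'b) type_term"
  assumes p: "valid_slots X p N A" and M: "1 \<le> M" "M < N" "p M = Inl y"
    and j: "1 \<le> j" "j < N"
  shows "subst (Var(y := slot_term p M a)) (slot_expr p j) =
    (slot_expr (p(M := Inr a)) j :: (nat \<times> 'a + nat \<times> 'b) expr)"
proof (rule subst_slot_expr)
  fix i x assume i: "1 \<le> i" "i \<le> j" "p i = Inl x"
  show "(Var(y := slot_term p M a)) x =
      (slot_expr (p(M := Inr a)) i :: (nat \<times> 'a + nat \<times> 'b) expr)"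
  proof (cases "i = M")
    case True
    have "slot_term p M a = (slot_term (p(M := Inr a)) M a :: (nat \<times> 'a + nat \<times> 'b) expr)"
      by (rule slot_term_cong) auto
    then show ?thesis
      using True i M by (simp add: slot_expr_Inr)
  next
    case False
    then have "x \<noteq> y"
      using p i j M unfolding valid_slots_def
      by (metis atLeastLessThan_iff le_less_trans isl_def)
    then show ?thesis
      using False i by (simp add: slot_expr_Inl)
  qed
qed (use M j in auto)

lemma slot_ctx_fill_slot:
  assumes p: "valid_slots X p N A" and M: "1 \<le> M" "M < N" "p M = Inl y"
  shows "slot_ctx X (p(M := Inr a)) N A =
     slot_ctx X p M (ancestor X N M A) @ subst_ctx (Var(y := slot_term p M a))
       (map (slot_decl X p N A) (filter (\<lambda>j. isl (p j)) [Suc M..<N]))"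
proof -
  let ?q = "p(M := Inr a)"
  have "var_slots ?q N = var_slots p M @ filter (\<lambda>j. isl (p j)) [Suc M..<N]"
    unfolding var_slots_def upt_split[OF M(1,2)] by (auto intro!: arg_cong2[where f = append] filter_cong)
  moreover have "map (slot_decl X ?q N A) (var_slots p M)
      = slot_ctx X p M (ancestor X N M A)"
    using M by (auto simp: slot_ctx_def set_var_slots slot_decl_def ancestor_ancestor
        intro!: slot_type_cong)
  moreover have "(case slot_decl X p N A j of (x, T) \<Rightarrow> (x, subst (Var(y := slot_term p M a)) T))
      = slot_decl X ?q N A j" if "Suc M \<le> j" "j < N" for j
    using that M subst_fill_slot[OF p M]
    by (auto simp: slot_decl_def intro!: subst_slot_type)
  ultimately show ?thesis
    by (auto simp: slot_ctx_def subst_ctx_def comp_def)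
qed

lemma valid_fill_slot:
  assumes "valid_slots X p N A" "1 \<le> M" "M < N" "a \<in> Tm X M (ancestor X N M A)"
  shows "valid_slots X (p(M := Inr a)) N A"
  using assms by (auto simp: valid_slots_def)

definition rename_slots :: "(var \<Rightarrow> var) \<Rightarrow> (nat \<Rightarrow> var + 'b) \<Rightarrow> nat \<Rightarrow> var + 'b" where
  "rename_slots \<sigma> p j = map_sum \<sigma> id (p j)"

lemma subst_rename_slots:
  "1 \<le> j \<Longrightarrow> subst (Var \<circ> \<sigma>) (slot_expr p j) = slot_expr (rename_slots \<sigma> p) j"
  by (rule subst_slot_expr) (auto simp: slot_expr_Inl rename_slots_def)

lemma slot_ctx_rename_slots:
  "slot_ctx X (rename_slots \<sigma> p) N A = permute_ctx \<sigma> (slot_ctx X p N A)"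
proof -
  have isl: "isl (rename_slots \<sigma> p j) = isl (p j)" for j
    by (cases "p j") (auto simp: rename_slots_def)
  have "slot_decl X (rename_slots \<sigma> p) N A j =
      (case slot_decl X p N A j of (x, T) \<Rightarrow> (\<sigma> x, subst (Var \<circ> \<sigma>) T))"
    if "isl (p j)" for j
    using that subst_slot_type[OF subst_rename_slots, of j \<sigma> p "ancestor X N j A"]
    by (cases "p j") (auto simp: slot_decl_def rename_slots_def)
  then show ?thesis
    by (auto simp: slot_ctx_def permute_ctx_def var_slots_def isl)
qed

lemma valid_rename_slots:
  assumes "valid_slots X p N A" "inj \<sigma>"
  shows "valid_slots X (rename_slots \<sigma> p) N A"
proof -
  have "isl (p i) \<and> p i = p j" if "isl (rename_slots \<sigma> p i)" "rename_slots \<sigma> p i = rename_slots \<sigma> p j"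
    for i j
    using that assms(2)
    by (cases "p i"; cases "p j") (auto simp: rename_slots_def dest: injD)
  moreover have "p j = Inr b" if "rename_slots \<sigma> p j = Inr b" for j b
    using that by (cases "p j") (auto simp: rename_slots_def)
  ultimately show ?thesis
    using assms(1) unfolding valid_slots_def by blast
qed


section \<open>Derived judgements of a free theory\<close>

lemma slot_judgementI:
  "valid_slots X p N A \<Longrightarrow> \<Gamma> = slot_ctx X p N A \<Longrightarrow> R \<in> slot_rhs X p N A \<Longrightarrow>
    slot_judgement X (\<Gamma> \<turnstile> R)"
  by (auto simp: slot_judgement_def)

lemma slot_judgement_TypeEq:
  "slot_judgement X (\<Gamma> \<turnstile> TypeEq T T') \<longleftrightarrow> T = T' \<and> slot_judgement X (\<Gamma> \<turnstile> IsType T)"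
  by (auto simp: slot_judgement_def slot_rhs_def)

lemma slot_judgement_TermEq:
  "slot_judgement X (\<Gamma> \<turnstile> TermEq t t' T) \<longleftrightarrow> t = t' \<and> slot_judgement X (\<Gamma> \<turnstile> HasType t T)"
  by (auto simp: slot_judgement_def slot_rhs_def)

text \<open>
  The type \<open>T\<close> is shared by both premises. Comparing its head constant and arguments in the two slot
  assignments shows that the slot \<open>M\<close> of \<open>y\<close> is the degree of the head constant of \<open>t\<close>, that this constant
  is a term-element over the ancestor in degree \<open>M\<close>, and that both assignments give the same
  expressions below \<open>M\<close>. So the conclusion is the second premise with slot \<open>M\<close> refilled.
\<close>

lemma slot_judgement_subst:
  assumes "slot_judgement X (\<Gamma> \<turnstile> HasType t T)" "slot_judgement X (\<Gamma> @ (y, T) # \<Delta> \<turnstile> R)"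
  shows "slot_judgement X (\<Gamma> @ subst_ctx (Var(y := t)) \<Delta> \<turnstile> subst_rhs (Var(y := t)) R)"
proof -
  obtain q K B a where q: "\<Gamma> = slot_ctx X q K B" "a \<in> Tm X K B" "t = slot_term q K a"
      "T = slot_type q K B"
    using assms(1) by (auto simp: slot_judgement_def slot_rhs_def)
  obtain p N A where p: "valid_slots X p N A" "slot_ctx X p N A = \<Gamma> @ (y, T) # \<Delta>"
      "R \<in> slot_rhs X p N A"
    using assms(2) by (auto simp: slot_judgement_def)
  obtain M where M: "1 \<le> M" "M < N" "p M = Inl y" "\<Gamma> = slot_ctx X p M (ancestor X N M A)"
      "T = slot_type p M (ancestor X N M A)"
      "\<Delta> = map (slot_decl X p N A) (filter (\<lambda>j. isl (p j)) [Suc M..<N])"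
    using slot_ctx_splitE[OF p(2)] by blast
  have KM: "K = M" "B = ancestor X N M A" "t = slot_term p M a"
    using q M(5) by (auto simp: slot_type_def slot_term_def)
  have "slot_ctx X (p(M := Inr a)) N A = \<Gamma> @ subst_ctx (Var(y := t)) \<Delta>"
    using slot_ctx_fill_slot[OF p(1) M(1-3)] M(4,6) KM by simp
  moreover have "valid_slots X (p(M := Inr a)) N A"
    using valid_fill_slot[OF p(1) M(1,2)] q(2) KM by blast
  moreover have "subst_rhs (Var(y := t)) R \<in> slot_rhs X (p(M := Inr a)) N A"
    unfolding KM(3) by (rule subst_slot_rhs[OF _ p(3)]) (rule subst_fill_slot[OF p(1) M(1-3)])
  ultimately show ?thesis
    by (intro slot_judgementI) simp_all
qed

lemma slot_judgement_permute:
  assumes "slot_judgement X J" "inj \<sigma>"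
  shows "slot_judgement X (permute \<sigma> J)"
proof -
  obtain p N A where p: "valid_slots X p N A" "ctx_of J = slot_ctx X p N A"
      "rhs_of J \<in> slot_rhs X p N A"
    using assms(1) by (auto simp: slot_judgement_def)
  have "subst_rhs (Var \<circ> \<sigma>) (rhs_of J) \<in> slot_rhs X (rename_slots \<sigma> p) N A"
    by (rule subst_slot_rhs[OF _ p(3)]) (rule subst_rename_slots)
  then show ?thesis
    using valid_rename_slots[OF p(1) assms(2)] slot_ctx_rename_slots[of X \<sigma> p N A] p(2)
    unfolding permute_def by (intro slot_judgementI) simp_all
qed

text \<open>
  The assignment \<open>Inl\<close>, with the variable \<open>x\<^sub>j\<close> in slot \<open>j\<close>, gives the generic judgements.
\<close>

lemma slot_expr_vars: "slot_expr Inl j = Var j"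
  by (simp add: slot_expr_Inl)

lemma slot_type_vars: "slot_type Inl n A = generic_type n A"
  by (auto simp: slot_type_def generic_type_def slot_expr_vars)

lemma slot_term_vars: "slot_term Inl n a = generic_term n a"
  by (auto simp: slot_term_def generic_term_def slot_expr_vars)

lemma slot_ctx_vars: "slot_ctx X Inl n A = generic_ctx X n A"
  by (auto simp: slot_ctx_def generic_ctx_def var_slots_def slot_decl_def slot_type_vars
      generic_type_def)

lemma basic_imp_slot_judgement:
  assumes "J \<in> basic (free_gat X)"
  shows "slot_judgement X J"
proof -
  have v: "valid_slots X Inl n A" if "1 \<le> n" "A \<in> ty X n" for n and A :: 'a
    using that by (auto simp: valid_slots_def)
  show ?thesis
    using assms v by (fastforce simp: free_gat_def slot_judgement_def slot_rhs_def
        slot_ctx_vars[symmetric] slot_type_vars[symmetric] slot_term_vars[symmetric])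
qed

text \<open>
  Equalities are carried along in the induction as pairs of identical expressions. Hence the two
  substitution rules for equalities reduce to the one for single terms, and conversion along a type
  equality changes nothing.
\<close>

theorem derived_imp_slot_judgement:
  "J \<in> derived (free_gat X) \<Longrightarrow> slot_judgement X J"
proof (induction rule: derived.induct)
  case (basic J)
  then show ?case
    by (simp add: basic_imp_slot_judgement)
next
  case (alpha \<Gamma> R \<sigma>)
  then show ?case
    using slot_judgement_permute[of X "\<Gamma> \<turnstile> R" \<sigma>] by (simp add: permute_def bij_is_inj)
next
  case (subst \<Gamma> t T y \<Delta> R)
  then show ?case
    by (intro slot_judgement_subst)
next
  case (subst_type_eq \<Gamma> t1 t2 T y \<Delta> T')
  then have "t1 = t2" "slot_judgement X (\<Gamma> \<turnstile> HasType t2 T)"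
    by (auto simp: slot_judgement_TermEq)
  then show ?case
    using slot_judgement_subst[OF _ subst_type_eq.IH(2)] by (simp add: slot_judgement_TypeEq)
next
  case (subst_term_eq \<Gamma> t1 t2 T y \<Delta> t' T')
  then have "t1 = t2" "slot_judgement X (\<Gamma> \<turnstile> HasType t2 T)"
    by (auto simp: slot_judgement_TermEq)
  then show ?case
    using slot_judgement_subst[OF _ subst_term_eq.IH(2)] by (simp add: slot_judgement_TermEq)
qed (auto simp: slot_judgement_TypeEq slot_judgement_TermEq)

lemma permute_derived:
  "J \<in> derived T \<Longrightarrow> bij \<sigma> \<Longrightarrow> permute \<sigma> J \<in> derived T"
  by (cases J) (simp add: permute_def derived.alpha)

lemma generic_derived:
  assumes "presheaf X" "1 \<le> n" "A \<in> ty X n" "R \<in> slot_rhs X Inl n A"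
  shows "(generic_ctx X n A \<turnstile> R) \<in> derived (free_gat X)"
proof -
  have ty: "(generic_ctx X n A \<turnstile> IsType (generic_type n A)) \<in> derived (free_gat X)"
    using assms by (intro generic_type_derived)
  moreover have "(generic_ctx X n A \<turnstile> HasType (generic_term n a) (generic_type n A))
      \<in> derived (free_gat X)" if "a \<in> Tm X n A" for a
  proof (rule derived.basic)
    show "(generic_ctx X n A \<turnstile> HasType (generic_term n a) (generic_type n A)) \<in> basic (free_gat X)"
      using assms(2,3) that unfolding free_gat_def by fastforce
  qed (use ty in simp)
  ultimately show ?thesis
    using assms(4) by (auto simp: slot_rhs_def slot_type_vars slot_term_vars
        intro: derived.type_refl derived.term_refl)
qed

text \<open>
  Induction on the number of slots that hold a term-element. If there are none, the judgement is a
  permuted generic one. Otherwise one such slot \<open>M\<close> is refilled with a fresh variable \<open>y\<close>; the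
  original judgement comes back by substituting for \<open>y\<close> the term that was in \<open>M\<close>. This term is
  itself derivable by induction, as it only involves the slots below \<open>M\<close>.
\<close>

theorem slot_judgement_derived:
  assumes X: "presheaf X" and "valid_slots X p N A" "R \<in> slot_rhs X p N A"
  shows "(slot_ctx X p N A \<turnstile> R) \<in> derived (free_gat X)"
  using assms(2,3)
proof (induction "card {j\<in>{1..<N}. \<not> isl (p j)}" arbitrary: p N A R rule: less_induct)
  case less
  note p = less.prems(1)
  show ?case
  proof (cases "\<forall>j\<in>{1..<N}. isl (p j)")
    case True
    have "inj_on (projl \<circ> p) {1..<N}"
      using p True unfolding valid_slots_def inj_on_def comp_def
      by (metis sum.expand)
    then obtain \<sigma> where \<sigma>: "bij \<sigma>" "\<And>j. j \<in> {1..<N} \<Longrightarrow> \<sigma> j = projl (p j)"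
      using ex_bij_extending[of "{1..<N}" "projl \<circ> p"] by auto
    have q: "rename_slots \<sigma> Inl i = p i" if "1 \<le> i" "i < N" for i
      using that True \<sigma>(2) by (auto simp: rename_slots_def)
    \<comment> \<open>Renaming back along \<open>inv \<sigma>\<close> gives a judgement in the generic context.\<close>
    define R' where "R' = subst_rhs (Var \<circ> inv \<sigma>) R"
    have "subst (Var \<circ> inv \<sigma>) (slot_expr p j) = (slot_expr Inl j :: (nat \<times> 'a + nat \<times> 'b) expr)"
      if "1 \<le> j" "j < N" for j
    proof -
      have "slot_expr p j = (Var (\<sigma> j) :: (nat \<times> 'a + nat \<times> 'b) expr)"
        using that True \<sigma>(2) by (intro slot_expr_Inl) auto
      then show ?thesis
        using \<sigma>(1) by (simp add: slot_expr_vars bij_is_inj)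
    qed
    then have "R' \<in> slot_rhs X Inl N A"
      unfolding R'_def by (rule subst_slot_rhs[OF _ less.prems(2)])
    then have "(generic_ctx X N A \<turnstile> R') \<in> derived (free_gat X)"
      using X p by (intro generic_derived) (auto simp: valid_slots_def)
    then have "permute \<sigma> (generic_ctx X N A \<turnstile> R') \<in> derived (free_gat X)"
      using \<sigma>(1) by (rule permute_derived)
    moreover have "permute_ctx \<sigma> (generic_ctx X N A) = slot_ctx X p N A"
      unfolding slot_ctx_vars[symmetric] slot_ctx_rename_slots[symmetric]
      by (rule slot_ctx_cong) (rule q)
    moreover have "permute \<sigma> (\<Gamma> \<turnstile> R') = (permute_ctx \<sigma> \<Gamma> \<turnstile> R)" for \<Gamma>
      using permute_id[of "\<Gamma> \<turnstile> R"] \<sigma>(1)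
      by (simp add: permute_def R'_def subst_rhs_subst_rhs comp_def bij_is_surj surj_f_inv_f)
    ultimately show ?thesis
      by simp
  next
    case False
    then obtain M a where M: "1 \<le> M" "M < N" "p M = Inr a"
      by (metis atLeastLessThan_iff sum.collapse(2))
    define B where "B = ancestor X N M A"
    have a: "a \<in> Tm X M B"
      using p M by (auto simp: valid_slots_def B_def)
    obtain y where y: "\<And>j. j \<in> {1..<N} \<Longrightarrow> p j \<noteq> Inl y"
    proof -
      obtain y where "y \<notin> (projl \<circ> p) ` {1..<N}"
        using ex_new_if_finite[of "(projl \<circ> p) ` {1..<N}"] by auto
      then show thesis
        using that[of y] by (metis comp_apply image_eqI sum.sel(1))
    qed
    define q where "q = p(M := Inl y)"
    have pq: "p = q(M := Inr a)"
      using M by (auto simp: q_def)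
    have q: "valid_slots X q N A"
      unfolding valid_slots_def
    proof (intro conjI ballI allI impI)
      fix i j assume "i \<in> {1..<N}" "j \<in> {1..<N}" "isl (q i) \<and> q i = q j"
      then show "i = j"
        using p y[of i] y[of j] by (auto simp: valid_slots_def q_def split: if_splits)
    next
      fix j b assume "j \<in> {1..<N}" "q j = Inr b"
      then show "b \<in> Tm X j (ancestor X N j A)"
        using p by (auto simp: valid_slots_def q_def split: if_splits)
    qed (use p in \<open>auto simp: valid_slots_def\<close>)
    have qM: "q M = Inl y"
      by (simp add: q_def)
    have "{j\<in>{1..<N}. \<not> isl (q j)} \<subseteq> {j\<in>{1..<N}. \<not> isl (p j)} - {M}"
      by (auto simp: q_def)
    moreover have "M \<in> {j\<in>{1..<N}. \<not> isl (p j)}"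
      using M by simp
    ultimately have "{j\<in>{1..<N}. \<not> isl (q j)} \<subset> {j\<in>{1..<N}. \<not> isl (p j)}"
      by blast
    then have card: "card {j\<in>{1..<N}. \<not> isl (q j)} < card {j\<in>{1..<N}. \<not> isl (p j)}"
      by (intro psubset_card_mono) auto
    have "card {j\<in>{1..<M}. \<not> isl (q j)} \<le> card {j\<in>{1..<N}. \<not> isl (q j)}"
      using M by (intro card_mono) auto
    then have "(slot_ctx X q M B \<turnstile> HasType (slot_term q M a) (slot_type q M B))
        \<in> derived (free_gat X)"
      using card a valid_slots_ancestor[OF X q] M
      by (intro less.hyps) (auto simp: B_def slot_rhs_def)
    moreover obtain R' where R': "R' \<in> slot_rhs X q N A" "R = subst_rhs (Var(y := slot_term q M a)) R'"
    proof -
      have "subst_rhs (Var(y := slot_term q M a)) ` slot_rhs X q N A = slot_rhs X p N A"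
        by (rule image_slot_rhs) (rule subst_fill_slot[OF q M(1,2) qM, of _ a, folded pq])
      then show thesis
        using that less.prems(2) by blast
    qed
    moreover have "(slot_ctx X q N A \<turnstile> R') \<in> derived (free_gat X)"
      using card q R'(1) by (rule less.hyps)
    ultimately show ?thesis
      using slot_ctx_split[where p = q, OF M(1,2) qM, of X A] slot_ctx_fill_slot[OF q M(1,2) qM, of a]
      by (auto simp: B_def pq[symmetric] intro: derived.subst)
  qed
qed


section \<open>Variables, prefixes and equalities of derived judgements\<close>

lemma map_fst_slot_ctx: "map fst (slot_ctx X p N A) = map (projl \<circ> p) (var_slots p N)"
  by (simp add: slot_ctx_def slot_decl_def comp_def)

lemma distinct_slot_ctx:
  assumes "valid_slots X p N A"
  shows "distinct (map fst (slot_ctx X p N A))"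
proof -
  have "inj_on (projl \<circ> p) (set (var_slots p N))"
  proof (rule inj_onI)
    fix i j assume ij: "i \<in> set (var_slots p N)" "j \<in> set (var_slots p N)"
      "(projl \<circ> p) i = (projl \<circ> p) j"
    then have "p i = p j"
      by (auto simp: set_var_slots intro: sum.expand)
    then show "i = j"
      using ij assms by (auto simp: set_var_slots valid_slots_def)
  qed
  then show ?thesis
    by (simp only: map_fst_slot_ctx distinct_map distinct_var_slots simp_thms)
qed

lemma vars_slot_term:
  assumes "\<And>j. 1 \<le> j \<Longrightarrow> j < N \<Longrightarrow> vars (slot_expr p j :: (nat \<times> 'a + nat \<times> 'b) expr) \<subseteq> V"
  shows "vars (slot_type p N A :: (nat \<times> 'a + nat \<times> 'b) expr) \<subseteq> V"
    and "vars (slot_term p N a :: (nat \<times> 'a + nat \<times> 'b) expr) \<subseteq> V"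
proof -
  have "vars (App w (map (slot_expr p) [1..<N]) :: (nat \<times> 'a + nat \<times> 'b) expr) \<subseteq> V" for w
  proof
    fix x assume "x \<in> vars (App w (map (slot_expr p) [1..<N]) :: (nat \<times> 'a + nat \<times> 'b) expr)"
    then obtain j where "1 \<le> j" "j < N" "x \<in> vars (slot_expr p j :: (nat \<times> 'a + nat \<times> 'b) expr)"
      by auto
    then show "x \<in> V"
      using assms by blast
  qed
  then show "vars (slot_type p N A :: (nat \<times> 'a + nat \<times> 'b) expr) \<subseteq> V"
    "vars (slot_term p N a :: (nat \<times> 'a + nat \<times> 'b) expr) \<subseteq> V"
    unfolding slot_type_def slot_term_def by blast+
qed

lemma vars_slot_expr:
  "1 \<le> j \<Longrightarrow> j < N \<Longrightarrow>
    vars (slot_expr p j :: (nat \<times> 'a + nat \<times> 'b) expr) \<subseteq> (projl \<circ> p) ` set (var_slots p N)"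
proof (induction j rule: less_induct)
  case (less j)
  show ?case
  proof (cases "p j")
    case (Inl x)
    then have "j \<in> set (var_slots p N)" "(projl \<circ> p) j = x"
      using less.prems by (auto simp: set_var_slots)
    then show ?thesis
      using imageI[of j "set (var_slots p N)" "projl \<circ> p"] Inl
      by (simp only: slot_expr_Inl vars.simps empty_subsetI insert_subset simp_thms)
  next
    case (Inr b)
    have "vars (slot_term p j b :: (nat \<times> 'a + nat \<times> 'b) expr)
        \<subseteq> (projl \<circ> p) ` set (var_slots p N)"
    proof (rule vars_slot_term(2))
      fix i assume "1 \<le> i" "i < j"
      then show "vars (slot_expr p i :: (nat \<times> 'a + nat \<times> 'b) expr)
          \<subseteq> (projl \<circ> p) ` set (var_slots p N)"
        using less.prems(2) by (intro less.IH) simp_all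
    qed
    then show ?thesis
      by (simp only: slot_expr_Inr[of p, OF Inr])
  qed
qed

lemma vars_slot_rhs:
  fixes p :: "nat \<Rightarrow> var + 'b" and A :: 'a
  shows "vars (slot_type p N A) \<subseteq> fst ` set (slot_ctx X p N A)"
    and "vars (slot_term p N a :: (nat \<times> 'a + nat \<times> 'b) expr) \<subseteq> fst ` set (slot_ctx X p N A)"
proof -
  have "fst ` set (slot_ctx X p N A) = (projl \<circ> p) ` set (var_slots p N)"
    using map_fst_slot_ctx[of X p N A] by (metis set_map)
  then show "vars (slot_type p N A) \<subseteq> fst ` set (slot_ctx X p N A)"
    "vars (slot_term p N a :: (nat \<times> 'a + nat \<times> 'b) expr) \<subseteq> fst ` set (slot_ctx X p N A)"
    using vars_slot_term[OF vars_slot_expr] by metis+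
qed

lemma derived_IsTypeE:
  assumes "(\<Gamma> \<turnstile> IsType S) \<in> derived (free_gat X)"
  obtains p N A where "valid_slots X p N A" "\<Gamma> = slot_ctx X p N A" "S = slot_type p N A"
  using derived_imp_slot_judgement[OF assms] unfolding slot_judgement_def slot_rhs_def by auto

lemma derived_HasTypeE:
  assumes "(\<Gamma> \<turnstile> HasType s S) \<in> derived (free_gat X)"
  obtains p N A a where "valid_slots X p N A" "\<Gamma> = slot_ctx X p N A" "S = slot_type p N A"
    "a \<in> Tm X N A" "s = slot_term p N a"
  using derived_imp_slot_judgement[OF assms] unfolding slot_judgement_def slot_rhs_def by auto

lemma derived_type_vars:
  assumes "(\<Gamma> \<turnstile> IsType S) \<in> derived (free_gat X)"
  shows "vars S \<subseteq> fst ` set \<Gamma>"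
proof -
  obtain p N A where p: "\<Gamma> = slot_ctx X p N A" "S = slot_type p N A"
    using assms by (rule derived_IsTypeE)
  show ?thesis
    unfolding p by (rule vars_slot_rhs)
qed

lemma derived_term_vars:
  assumes "(\<Gamma> \<turnstile> HasType s S) \<in> derived (free_gat X)"
  shows "vars s \<subseteq> fst ` set \<Gamma>"
proof -
  obtain p N A a where p: "\<Gamma> = slot_ctx X p N A" "s = slot_term p N a"
    using assms by (rule derived_HasTypeE)
  show ?thesis
    unfolding p by (rule vars_slot_rhs)
qed

lemma derived_type_of_term:
  assumes "presheaf X" "(\<Gamma> \<turnstile> HasType s S) \<in> derived (free_gat X)"
  shows "(\<Gamma> \<turnstile> IsType S) \<in> derived (free_gat X)"
  using assms(2)
  by (rule derived_HasTypeE) (auto intro!: slot_judgement_derived assms simp: slot_rhs_def)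

text \<open>
  Presupposition: the types declared in a derived judgement are themselves derived, since cutting
  off the context at a declaration cuts off the slot assignment at the corresponding slot. The
  index \<open>i = length \<Gamma>\<close> covers the type \<open>S\<close> itself, as in the definition of \<open>\<equiv>\<close>.
\<close>

lemma derived_take_ctx:
  assumes X: "presheaf X" and d: "(\<Gamma> \<turnstile> IsType S) \<in> derived (free_gat X)" and i: "i \<le> length \<Gamma>"
  shows "(take i \<Gamma> \<turnstile> IsType ((map snd \<Gamma> @ [S]) ! i)) \<in> derived (free_gat X)"
proof (cases "i = length \<Gamma>")
  case True
  then show ?thesis
    using d by (simp add: nth_append)
next
  case False
  then have i: "i < length \<Gamma>"
    using i by simp
  obtain y T where yT: "\<Gamma> ! i = (y, T)"
    by fastforce
  have \<Gamma>: "\<Gamma> = take i \<Gamma> @ (y, T) # drop (Suc i) \<Gamma>"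
    using id_take_nth_drop[OF i] yT by simp
  obtain p N A where p: "valid_slots X p N A" "\<Gamma> = slot_ctx X p N A"
    using d by (rule derived_IsTypeE)
  obtain M where M: "1 \<le> M" "M < N" "take i \<Gamma> = slot_ctx X p M (ancestor X N M A)"
      "T = slot_type p M (ancestor X N M A)"
    using slot_ctx_splitE[of X p N A "take i \<Gamma>"] \<Gamma> p(2) by metis
  have "(take i \<Gamma> \<turnstile> IsType T) \<in> derived (free_gat X)"
    unfolding M(3,4) using M(1,2) p(1)
    by (intro slot_judgement_derived valid_slots_ancestor X) (auto simp: slot_rhs_def)
  then show ?thesis
    using i yT by (simp add: nth_append)
qed

lemma derived_TypeEq_iff:
  assumes "(\<Gamma> \<turnstile> IsType T) \<in> derived (free_gat X)"
  shows "(\<Gamma> \<turnstile> TypeEq T T') \<in> derived (free_gat X) \<longleftrightarrow> T = T'"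
  using assms derived_imp_slot_judgement[of "\<Gamma> \<turnstile> TypeEq T T'" X]
  by (auto simp: slot_judgement_TypeEq intro: derived.type_refl)

lemma derived_TermEq_iff:
  assumes "(\<Gamma> \<turnstile> HasType t T) \<in> derived (free_gat X)"
  shows "(\<Gamma> \<turnstile> TermEq t t' T) \<in> derived (free_gat X) \<longleftrightarrow> t = t'"
  using assms derived_imp_slot_judgement[of "\<Gamma> \<turnstile> TermEq t t' T" X]
  by (auto simp: slot_judgement_TermEq intro: derived.term_refl)


section \<open>The relation \<open>\<equiv>\<close> as an orbit relation\<close>

lemma renaming_map: "v \<in> set ys \<Longrightarrow> renaming (map \<sigma> ys) ys v = Var (\<sigma> v)"
  by (simp add: renaming_def map_of_zip_map)

lemma subst_renaming_map:
  "vars T \<subseteq> set ys \<Longrightarrow> subst (renaming (map \<sigma> ys) ys) T = subst (Var \<circ> \<sigma>) T"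
  by (rule subst_cong_vars) (auto simp: renaming_map)

lemma eq_permute_ctx_iff:
  assumes "map fst \<Gamma> = map \<sigma> (map fst \<Delta>)"
  shows "\<Gamma> = permute_ctx \<sigma> \<Delta> \<longleftrightarrow> map snd \<Gamma> = map (subst (Var \<circ> \<sigma>)) (map snd \<Delta>)"
proof -
  have "map fst (permute_ctx \<sigma> \<Delta>) = map \<sigma> (map fst \<Delta>)"
    "map snd (permute_ctx \<sigma> \<Delta>) = map (subst (Var \<circ> \<sigma>)) (map snd \<Delta>)"
    by (auto simp: permute_ctx_def)
  then show ?thesis
    using assms by (metis pair_list_eqI)
qed

text \<open>
  The \<open>i\<close>-th condition in \<open>\<equiv>\<close> renames only the variables of the first \<open>i\<close> declarations. These are
  all the variables of the type at position \<open>i\<close>, so on it the renaming agrees with \<open>\<sigma>\<close>, and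
  derivable equality is identity. As \<open>\<sigma>\<close> only has to match the declared variables, one may take a
  permutation extending this matching, or the identity if both contexts declare the same variables.
\<close>

lemma type_equiv_iff_permute:
  assumes X: "presheaf X"
    and \<Gamma>: "(\<Gamma> \<turnstile> IsType S) \<in> derived (free_gat X)" and \<Delta>: "(\<Delta> \<turnstile> IsType T) \<in> derived (free_gat X)"
    and \<sigma>: "map fst \<Gamma> = map \<sigma> (map fst \<Delta>)"
  shows "type_equiv (free_gat X) \<Gamma> S \<Delta> T \<longleftrightarrow> \<Gamma> = permute_ctx \<sigma> \<Delta> \<and> S = subst (Var \<circ> \<sigma>) T"
proof -
  have len: "length \<Gamma> = length \<Delta>"
    using \<sigma> by (metis length_map)
  have eq: "(take i \<Gamma> \<turnstile> TypeEq ((map snd \<Gamma> @ [S]) ! i)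
      (subst (renaming (map fst (take i \<Gamma>)) (map fst (take i \<Delta>))) ((map snd \<Delta> @ [T]) ! i)))
        \<in> derived (free_gat X) \<longleftrightarrow>
      (map snd \<Gamma> @ [S]) ! i = map (subst (Var \<circ> \<sigma>)) (map snd \<Delta> @ [T]) ! i"
    if i: "i \<le> length \<Gamma>" for i
  proof -
    have "map fst (take i \<Gamma>) = map \<sigma> (map fst (take i \<Delta>))"
      using \<sigma> by (metis take_map)
    moreover have "vars ((map snd \<Delta> @ [T]) ! i) \<subseteq> set (map fst (take i \<Delta>))"
      using derived_type_vars[OF derived_take_ctx[OF X \<Delta>]] i len by simp
    ultimately have "subst (renaming (map fst (take i \<Gamma>)) (map fst (take i \<Delta>))) ((map snd \<Delta> @ [T]) ! i)
        = subst (Var \<circ> \<sigma>) ((map snd \<Delta> @ [T]) ! i)"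
      by (simp only: subst_renaming_map)
    also have "\<dots> = map (subst (Var \<circ> \<sigma>)) (map snd \<Delta> @ [T]) ! i"
      using i len by (intro nth_map[symmetric]) simp
    finally show ?thesis
      using derived_TypeEq_iff[OF derived_take_ctx[OF X \<Gamma> i]] by simp
  qed
  have "type_equiv (free_gat X) \<Gamma> S \<Delta> T \<longleftrightarrow>
      (\<forall>i\<le>length \<Gamma>. (map snd \<Gamma> @ [S]) ! i = map (subst (Var \<circ> \<sigma>)) (map snd \<Delta> @ [T]) ! i)"
    using eq len by (simp add: type_equiv_def)
  also have "\<dots> \<longleftrightarrow> map snd \<Gamma> @ [S] = map (subst (Var \<circ> \<sigma>)) (map snd \<Delta> @ [T])"
    using len by (simp add: list_eq_iff_nth_eq less_Suc_eq_le)
  also have "\<dots> \<longleftrightarrow> \<Gamma> = permute_ctx \<sigma> \<Delta> \<and> S = subst (Var \<circ> \<sigma>) T"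
    using eq_permute_ctx_iff[OF \<sigma>] by simp
  finally show ?thesis .
qed

definition type_or_term :: "'w judgement \<Rightarrow> bool" where
  "type_or_term J \<longleftrightarrow> is_type_judgement J \<or> is_term_judgement J"

lemma judgement_equiv_imp:
  "judgement_equiv T J K \<Longrightarrow> type_or_term J \<and> length (ctx_of J) = length (ctx_of K)"
  by (induction T J K rule: judgement_equiv.induct)
    (auto simp: type_or_term_def is_type_judgement_def is_term_judgement_def type_equiv_def)

lemma judgement_equiv_iff_permute:
  assumes X: "presheaf X" and J: "J \<in> derived (free_gat X)" "type_or_term J"
    and K: "K \<in> derived (free_gat X)" and \<sigma>: "map fst (ctx_of J) = map \<sigma> (map fst (ctx_of K))"
  shows "judgement_equiv (free_gat X) J K \<longleftrightarrow> J = permute \<sigma> K"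
proof -
  consider (ty) \<Gamma> S where "J = (\<Gamma> \<turnstile> IsType S)" | (tm) \<Gamma> s S where "J = (\<Gamma> \<turnstile> HasType s S)"
    using J(2) by (auto simp: type_or_term_def is_type_judgement_def is_term_judgement_def)
  then show ?thesis
  proof cases
    case ty
    show ?thesis
    proof (cases "rhs_of K")
      case (IsType T)
      then obtain \<Delta> where \<Delta>: "K = (\<Delta> \<turnstile> IsType T)"
        by (metis judgement.collapse)
      show ?thesis
        using type_equiv_iff_permute[OF X, of \<Gamma> S \<Delta> T \<sigma>] J K \<sigma>
        unfolding ty \<Delta> by (simp add: permute_def)
    qed (cases K, simp add: ty permute_def)+
  next
    case tm
    show ?thesis
    proof (cases "rhs_of K")
      case (HasType t T)
      then obtain \<Delta> where \<Delta>: "K = (\<Delta> \<turnstile> HasType t T)"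
        by (metis judgement.collapse)
      have "type_equiv (free_gat X) \<Gamma> S \<Delta> T \<longleftrightarrow> \<Gamma> = permute_ctx \<sigma> \<Delta> \<and> S = subst (Var \<circ> \<sigma>) T"
        using derived_type_of_term[OF X] J(1) K \<sigma> unfolding tm \<Delta>
        by (intro type_equiv_iff_permute X) (auto simp del: map_map)
      moreover have "subst (renaming (map fst \<Gamma>) (map fst \<Delta>)) t = subst (Var \<circ> \<sigma>) t"
        using \<sigma> derived_term_vars K unfolding tm \<Delta> by (metis judgement.sel(1) set_map subst_renaming_map)
      ultimately show ?thesis
        using derived_TermEq_iff[of \<Gamma> s S X] J(1) unfolding tm \<Delta> by (auto simp: permute_def)
    qed (cases K, simp add: tm permute_def)+
  qed
qed

lemma derived_distinct_ctx:
  assumes "J \<in> derived (free_gat X)"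
  shows "distinct (map fst (ctx_of J))"
  using derived_imp_slot_judgement[OF assms] distinct_slot_ctx by (metis slot_judgement_def)

lemma map_fst_permute: "map fst (ctx_of (permute \<sigma> K)) = map \<sigma> (map fst (ctx_of K))"
  by (auto simp: permute_def permute_ctx_def)

lemma ex_bij_map_eq:
  assumes "distinct xs" "distinct ys" "length xs = length ys"
  obtains \<sigma> :: "'a \<Rightarrow> 'a" where "bij \<sigma>" "xs = map \<sigma> ys"
proof -
  define f where "f = (\<lambda>y. the (map_of (zip ys xs) y))"
  have f: "map f ys = xs"
    using assms by (intro nth_equalityI) (auto simp: f_def map_of_zip_nth)
  then have "inj_on f (set ys)"
    using assms(1) by (metis distinct_map)
  then obtain \<sigma> where "bij \<sigma>" "\<And>y. y \<in> set ys \<Longrightarrow> \<sigma> y = f y"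
    using ex_bij_extending[of "set ys" f] by auto
  then show thesis
    using that[of \<sigma>] f by (metis map_cong)
qed

text \<open>
  The classes are the orbits of the permutations of the variables. For the direction from left to
  right, the declared variables of the two contexts are distinct and equally many, so some
  permutation matches them.
\<close>

theorem equiv_rel_iff_permute:
  assumes X: "presheaf X"
  shows "(J, K) \<in> equiv_rel (free_gat X) \<longleftrightarrow>
    J \<in> derived (free_gat X) \<and> K \<in> derived (free_gat X) \<and> type_or_term J \<and>
    (\<exists>\<sigma>. bij \<sigma> \<and> J = permute \<sigma> K)"
proof
  assume "(J, K) \<in> equiv_rel (free_gat X)"
  then have JK: "J \<in> derived (free_gat X)" "K \<in> derived (free_gat X)"
      "judgement_equiv (free_gat X) J K"
    by (auto simp: equiv_rel_def)
  from JK(3) have tt: "type_or_term J" and "length (ctx_of J) = length (ctx_of K)"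
    using judgement_equiv_imp by blast+
  then obtain \<sigma> where "bij \<sigma>" "map fst (ctx_of J) = map \<sigma> (map fst (ctx_of K))"
    using ex_bij_map_eq[of "map fst (ctx_of J)" "map fst (ctx_of K)"] JK derived_distinct_ctx
    by (metis length_map)
  then show "J \<in> derived (free_gat X) \<and> K \<in> derived (free_gat X) \<and> type_or_term J \<and>
      (\<exists>\<sigma>. bij \<sigma> \<and> J = permute \<sigma> K)"
    using judgement_equiv_iff_permute[OF X JK(1) tt JK(2)] JK tt by blast
next
  assume "J \<in> derived (free_gat X) \<and> K \<in> derived (free_gat X) \<and> type_or_term J \<and>
    (\<exists>\<sigma>. bij \<sigma> \<and> J = permute \<sigma> K)"
  then show "(J, K) \<in> equiv_rel (free_gat X)"
    using judgement_equiv_iff_permute[OF X, of J K] map_fst_permute[of _ K]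
    by (auto simp: equiv_rel_def)
qed

text \<open>
  An orbit contains at most one judgement whose context declares a given list of variables,
  because such a judgement contains no other variables.
\<close>

lemma equiv_rel_same_vars:
  assumes "presheaf X" "(J, K) \<in> equiv_rel (free_gat X)" "map fst (ctx_of J) = map fst (ctx_of K)"
  shows "J = K"
proof -
  have "judgement_equiv (free_gat X) J K \<longleftrightarrow> J = permute id K"
    using assms equiv_rel_iff_permute[OF assms(1), of J K]
    by (intro judgement_equiv_iff_permute) auto
  then show ?thesis
    using assms(2) by (simp add: equiv_rel_def permute_id)
qed

lemma is_type_judgement_permute [simp]:
  "is_type_judgement (permute \<sigma> J) = is_type_judgement J"
  by (cases J; cases "rhs_of J") (auto simp: is_type_judgement_def permute_def)

lemma is_term_judgement_permute [simp]:
  "is_term_judgement (permute \<sigma> J) = is_term_judgement J"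
  by (cases J; cases "rhs_of J") (auto simp: is_term_judgement_def permute_def)

lemma type_or_term_permute [simp]: "type_or_term (permute \<sigma> J) = type_or_term J"
  by (simp add: type_or_term_def)

lemma equiv_equiv_rel:
  assumes X: "presheaf X"
  shows "equiv {J \<in> derived (free_gat X). type_or_term J} (equiv_rel (free_gat X))"
proof (intro equivI)
  note iff = equiv_rel_iff_permute[OF X]
  show "equiv_rel (free_gat X) \<subseteq>
      {J \<in> derived (free_gat X). type_or_term J} \<times> {J \<in> derived (free_gat X). type_or_term J}"
    using iff by auto
  show "refl_on {J \<in> derived (free_gat X). type_or_term J} (equiv_rel (free_gat X))"
  proof (rule refl_onI)
    fix J assume "J \<in> {J \<in> derived (free_gat X). type_or_term J}"
    then show "(J, J) \<in> equiv_rel (free_gat X)"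
      using iff permute_id[of J] bij_id by auto
  qed
  show "sym (equiv_rel (free_gat X))"
  proof (rule symI)
    fix J K assume "(J, K) \<in> equiv_rel (free_gat X)"
    then obtain \<sigma> where \<sigma>: "bij \<sigma>" "J = permute \<sigma> K" and
        JK: "J \<in> derived (free_gat X)" "K \<in> derived (free_gat X)" "type_or_term J"
      using iff by blast
    then have "K = permute (inv \<sigma>) J" "bij (inv \<sigma>)" "type_or_term K"
      using permute_inv bij_imp_bij_inv by auto
    then show "(K, J) \<in> equiv_rel (free_gat X)"
      using JK iff by blast
  qed
  show "trans (equiv_rel (free_gat X))"
  proof (rule transI)
    fix J K L assume "(J, K) \<in> equiv_rel (free_gat X)" "(K, L) \<in> equiv_rel (free_gat X)"
    then obtain \<sigma> \<tau> where "bij \<sigma>" "J = permute \<sigma> K" "bij \<tau>" "K = permute \<tau> L" and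
        JL: "J \<in> derived (free_gat X)" "L \<in> derived (free_gat X)" "type_or_term J"
      using iff by blast
    then have "J = permute (\<sigma> \<circ> \<tau>) L" "bij (\<sigma> \<circ> \<tau>)"
      by (auto simp: permute_permute bij_comp)
    then show "(J, L) \<in> equiv_rel (free_gat X)"
      using JL iff by blast
  qed
qed

lemma boundary_permute:
  "type_or_term J \<Longrightarrow> boundary (permute \<sigma> J) = map (permute \<sigma>) (boundary J)"
  by (auto simp: type_or_term_def is_type_judgement_def is_term_judgement_def permute_def
      permute_ctx_def map_butlast last_map split: prod.split)

lemma boundary_derived:
  assumes X: "presheaf X" and J: "J \<in> derived (free_gat X)" "type_or_term J"
    and K: "K \<in> set (boundary J)"
  shows "K \<in> derived (free_gat X)" "is_type_judgement K"
proof -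
  consider (ty) \<Gamma> S where "J = (\<Gamma> \<turnstile> IsType S)" | (tm) \<Gamma> s S where "J = (\<Gamma> \<turnstile> HasType s S)"
    using J(2) by (auto simp: type_or_term_def is_type_judgement_def is_term_judgement_def)
  then have "K \<in> derived (free_gat X) \<and> is_type_judgement K"
  proof cases
    case ty
    then have "\<Gamma> \<noteq> []" and K: "K = (butlast \<Gamma> \<turnstile> IsType (snd (last \<Gamma>)))"
      using K by (auto split: if_splits)
    then have "(map snd \<Gamma> @ [S]) ! (length \<Gamma> - 1) = snd (last \<Gamma>)"
      by (simp add: nth_append last_conv_nth)
    then show ?thesis
      using derived_take_ctx[OF X, of \<Gamma> S "length \<Gamma> - 1"] J ty K
      by (simp add: butlast_conv_take is_type_judgement_def)
  next
    case tm
    then show ?thesis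
      using derived_type_of_term[OF X] J K by (auto simp: is_type_judgement_def)
  qed
  then show "K \<in> derived (free_gat X)" "is_type_judgement K"
    by auto
qed

text \<open>
  The boundary of a class can be computed from any representative, since forming the boundary
  commutes with permutations of the variables.
\<close>

lemma boundary_class:
  assumes X: "presheaf X" and J: "J \<in> derived (free_gat X)" "type_or_term J"
    and K: "boundary J = [K]"
  shows "(\<Union>J'\<in>equiv_rel (free_gat X) `` {J}. equiv_rel (free_gat X) `` set (boundary J')) =
    equiv_rel (free_gat X) `` {K}"
proof -
  let ?E = "equiv_rel (free_gat X)"
  note iff = equiv_rel_iff_permute[OF X] and equiv = equiv_equiv_rel[OF X]
  have "?E `` set (boundary J') = ?E `` {K}" if "(J, J') \<in> ?E" for J'
  proof -
    have "\<exists>\<sigma>. bij \<sigma> \<and> J = permute \<sigma> J'" and "J' \<in> derived (free_gat X)"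
      using that iff[of J J'] by auto
    then obtain \<sigma> where \<sigma>: "bij \<sigma>" "J = permute \<sigma> J'"
        and J': "J' \<in> derived (free_gat X)" "type_or_term J'"
      using J(2) by auto
    then have "map (permute \<sigma>) (boundary J') = [K]"
      using K boundary_permute[OF J'(2), of \<sigma>] \<sigma>(2) by simp
    then obtain K' where K': "boundary J' = [K']" "K = permute \<sigma> K'"
      by (auto simp: map_eq_Cons_conv)
    have "(K, K') \<in> ?E"
      using boundary_derived[OF X J, of K] boundary_derived[OF X J', of K'] K K' \<sigma> iff[of K K']
      by (auto simp: type_or_term_def)
    then show ?thesis
      using equiv_class_eq[OF equiv] K'(1) by fastforce
  qed
  moreover have "(J, J) \<in> ?E"
    using J equiv by (simp add: equiv_def refl_on_def)
  ultimately show ?thesis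
    by auto
qed


section \<open>Inc-lists as slot assignments\<close>

definition inc_slots ::
    "nat \<Rightarrow> (nat \<Rightarrow> nat) \<Rightarrow> (nat, nat, 'a, 'b) tt_map \<Rightarrow> nat \<Rightarrow> var + 'b" where
  "inc_slots n \<alpha> h j =
     (if j \<in> \<alpha> ` {1..n} then Inl (the_inv_into {1..n} \<alpha> j) else Inr (tm_map h j j))"

lemma arg_expr_eq_slot_expr: "arg_expr n \<alpha> h j = slot_expr (inc_slots n \<alpha> h) j"
proof (induction j rule: less_induct)
  case (less j)
  have args: "map (arg_expr n \<alpha> h) [1..<j] = map (slot_expr (inc_slots n \<alpha> h)) [1..<j]"
    using less.IH by simp
  show ?case
  proof (cases "j \<in> \<alpha> ` {1..n}")
    case True
    then have "inc_slots n \<alpha> h j = Inl (the_inv_into {1..n} \<alpha> j)"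
      by (simp add: inc_slots_def)
    then show ?thesis
      using True by (simp add: arg_expr.simps[of n \<alpha> h j] slot_expr_Inl)
  next
    case False
    then have "inc_slots n \<alpha> h j = Inr (tm_map h j j)"
      by (simp add: inc_slots_def)
    then show ?thesis
      using False args by (simp add: arg_expr.simps[of n \<alpha> h j] slot_expr_Inr slot_term_def)
  qed
qed

lemma Inc_strict: "\<alpha> \<in> Inc n \<Longrightarrow> i < j \<Longrightarrow> j \<le> n \<Longrightarrow> \<alpha> i < \<alpha> j"
  by (auto simp: Inc_def strict_mono_on_def)

lemma Inc_0: "\<alpha> \<in> Inc n \<Longrightarrow> \<alpha> 0 = 0"
  by (simp add: Inc_def)

lemma Inc_pos: "\<alpha> \<in> Inc n \<Longrightarrow> 1 \<le> i \<Longrightarrow> i \<le> n \<Longrightarrow> 1 \<le> \<alpha> i"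
  using Inc_strict[of \<alpha> n 0 i] by simp

lemma Inc_le: "\<alpha> \<in> Inc n \<Longrightarrow> i \<le> j \<Longrightarrow> j \<le> n \<Longrightarrow> \<alpha> i \<le> \<alpha> j"
  using Inc_strict[of \<alpha> n i j] by (cases "i = j") auto

lemma Inc_less_iff: "\<alpha> \<in> Inc n \<Longrightarrow> i \<le> n \<Longrightarrow> j \<le> n \<Longrightarrow> \<alpha> i < \<alpha> j \<longleftrightarrow> i < j"
  using Inc_strict Inc_le by (metis leD leI)

lemma Inc_inj: "\<alpha> \<in> Inc n \<Longrightarrow> inj_on \<alpha> {1..n}"
  by (rule strict_mono_on_imp_inj_on) (auto simp: Inc_def strict_mono_on_def)

lemma Inc_image: "\<alpha> \<in> Inc n \<Longrightarrow> 1 \<le> j \<Longrightarrow> j \<in> \<alpha> ` {0..n} \<longleftrightarrow> j \<in> \<alpha> ` {1..n}"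
proof -
  assume "\<alpha> \<in> Inc n" "1 \<le> j"
  moreover have "{0..n} = insert 0 {1..n}"
    by auto
  ultimately show ?thesis
    using Inc_0[of \<alpha> n] by auto
qed

lemma inc_slots_Inl: "\<alpha> \<in> Inc n \<Longrightarrow> 1 \<le> i \<Longrightarrow> i \<le> n \<Longrightarrow> inc_slots n \<alpha> h (\<alpha> i) = Inl i"
  using the_inv_into_f_f[OF Inc_inj, of \<alpha> n i] by (simp add: inc_slots_def)

lemma inc_slots_Inr: "j \<notin> \<alpha> ` {1..n} \<Longrightarrow> inc_slots n \<alpha> h j = Inr (tm_map h j j)"
  by (simp add: inc_slots_def)

lemma isl_inc_slots: "isl (inc_slots n \<alpha> h j) \<longleftrightarrow> j \<in> \<alpha> ` {1..n}"
  by (simp add: inc_slots_def)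

lemma var_slots_inc_slots:
  assumes \<alpha>: "\<alpha> \<in> Inc n"
  shows "var_slots (inc_slots n \<alpha> h) (\<alpha> n) = map \<alpha> [1..<n]"
proof (rule strict_sorted_equal)
  show "sorted_wrt (<) (map \<alpha> [1..<n])"
    using Inc_strict[OF \<alpha>] by (auto simp: sorted_wrt_iff_nth_less)
  show "sorted_wrt (<) (var_slots (inc_slots n \<alpha> h) (\<alpha> n))"
    unfolding var_slots_def by (intro sorted_wrt_filter) simp
  show "set (var_slots (inc_slots n \<alpha> h) (\<alpha> n)) = set (map \<alpha> [1..<n])"
    using Inc_less_iff[OF \<alpha>] Inc_pos[OF \<alpha>]
    by (auto simp: set_var_slots isl_inc_slots)
qed

lemma hom_inc_ty:
  assumes "h \<in> hom (inc_presheaf n \<alpha>) X" "1 \<le> j" "j \<le> \<alpha> n"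
  shows "ty_map h j j \<in> ty X j"
proof -
  have "ty_map h \<in> (\<Pi>\<^sub>E j\<in>{1..}. ty (inc_presheaf n \<alpha>) j \<rightarrow>\<^sub>E ty X j)"
    using assms(1) by (simp add: hom_def)
  from PiE_mem[OF this, of j] have "ty_map h j \<in> ty (inc_presheaf n \<alpha>) j \<rightarrow>\<^sub>E ty X j"
    using assms(2) by simp
  from PiE_mem[OF this, of j] show ?thesis
    by (simp add: inc_presheaf_def assms(3))
qed

lemma hom_inc_bd:
  assumes "h \<in> hom (inc_presheaf n \<alpha>) X" "1 \<le> j" "j < \<alpha> n"
  shows "ty_map h j j = bd X j (ty_map h (Suc j) (Suc j))"
proof -
  have "\<forall>n'\<ge>1. \<forall>A\<in>ty (inc_presheaf n \<alpha>) (Suc n').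
      ty_map h n' (bd (inc_presheaf n \<alpha>) n' A) = bd X n' (ty_map h (Suc n') A)"
    using assms(1) by (simp add: hom_def)
  moreover have "Suc j \<in> ty (inc_presheaf n \<alpha>) (Suc j)" "bd (inc_presheaf n \<alpha>) j (Suc j) = j"
    using assms(3) by (simp_all add: inc_presheaf_def)
  ultimately show ?thesis
    using assms(2) by metis
qed

lemma hom_inc_tm:
  assumes "h \<in> hom (inc_presheaf n \<alpha>) X" "1 \<le> j" "j \<le> \<alpha> n" "j \<notin> \<alpha> ` {0..n}"
  shows "tm_map h j j \<in> Tm X j (ty_map h j j)"
proof -
  have j: "j \<in> tm (inc_presheaf n \<alpha>) j" "tbd (inc_presheaf n \<alpha>) j j = j"
    using assms(3,4) by (simp_all add: inc_presheaf_def)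
  have "tm_map h \<in> (\<Pi>\<^sub>E j\<in>{1..}. tm (inc_presheaf n \<alpha>) j \<rightarrow>\<^sub>E tm X j)"
    and *: "\<forall>n'\<ge>1. \<forall>a\<in>tm (inc_presheaf n \<alpha>) n'.
      ty_map h n' (tbd (inc_presheaf n \<alpha>) n' a) = tbd X n' (tm_map h n' a)"
    using assms(1) by (simp_all add: hom_def)
  from PiE_mem[OF this(1), of j] have "tm_map h j \<in> tm (inc_presheaf n \<alpha>) j \<rightarrow>\<^sub>E tm X j"
    using assms(2) by simp
  from PiE_mem[OF this j(1)] have "tm_map h j j \<in> tm X j" .
  moreover have "ty_map h j j = tbd X j (tm_map h j j)"
    using * assms(2) j by metis
  ultimately show ?thesis
    by (simp add: Tm_def)
qed

text \<open>
  Naturality determines \<open>h\<close> on all type-elements from its value at the top degree \<open>\<alpha>(n)\<close>. So \<open>h\<close>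
  amounts to this value and the term-elements in the slots outside the image of \<open>\<alpha>\<close>.
\<close>

lemma hom_inc_ancestor:
  assumes h: "h \<in> hom (inc_presheaf n \<alpha>) X" and j: "1 \<le> j" "j \<le> \<alpha> n"
  shows "ty_map h j j = ancestor X (\<alpha> n) j (ty_map h (\<alpha> n) (\<alpha> n))"
  using j(2)
proof (induction rule: inc_induct)
  case base
  then show ?case
    by simp
next
  case (step m)
  have "ty_map h m m = bd X m (ancestor X (\<alpha> n) (Suc m) (ty_map h (\<alpha> n) (\<alpha> n)))"
    using hom_inc_bd[OF h, of m] step j(1) by simp
  also have "\<dots> = ancestor X (\<alpha> n) m (ty_map h (\<alpha> n) (\<alpha> n))"
    using step.hyps by (subst ancestor_ancestor[symmetric, of m "Suc m"]) (simp_all add: ancestor_Suc)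
  finally show ?case .
qed

lemma hom_inc_eqI:
  assumes h: "h \<in> hom (inc_presheaf n \<alpha>) X" and k: "k \<in> hom (inc_presheaf n \<alpha>) X"
    and ty: "\<And>j. 1 \<le> j \<Longrightarrow> j \<le> \<alpha> n \<Longrightarrow> ty_map h j j = ty_map k j j"
    and tm: "\<And>j. 1 \<le> j \<Longrightarrow> j \<le> \<alpha> n \<Longrightarrow> j \<notin> \<alpha> ` {0..n} \<Longrightarrow> tm_map h j j = tm_map k j j"
  shows "h = k"
proof -
  let ?P = "inc_presheaf n \<alpha>"
  have "ty_map h = ty_map k"
  proof (rule PiE_ext)
    show ty_h: "ty_map h \<in> (\<Pi>\<^sub>E j\<in>{1..}. ty ?P j \<rightarrow>\<^sub>E ty X j)" and
      ty_k: "ty_map k \<in> (\<Pi>\<^sub>E j\<in>{1..}. ty ?P j \<rightarrow>\<^sub>E ty X j)"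
      using h k by (auto simp: hom_def)
    fix j :: nat assume j: "j \<in> {1..}"
    show "ty_map h j = ty_map k j"
      using PiE_mem[OF ty_h j] PiE_mem[OF ty_k j]
      by (rule PiE_ext) (use ty j in \<open>auto simp: inc_presheaf_def split: if_splits\<close>)
  qed
  moreover have "tm_map h = tm_map k"
  proof (rule PiE_ext)
    show tm_h: "tm_map h \<in> (\<Pi>\<^sub>E j\<in>{1..}. tm ?P j \<rightarrow>\<^sub>E tm X j)" and
      tm_k: "tm_map k \<in> (\<Pi>\<^sub>E j\<in>{1..}. tm ?P j \<rightarrow>\<^sub>E tm X j)"
      using h k by (auto simp: hom_def)
    fix j :: nat assume j: "j \<in> {1..}"
    show "tm_map h j = tm_map k j"
      using PiE_mem[OF tm_h j] PiE_mem[OF tm_k j]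
      by (rule PiE_ext) (use tm j in \<open>auto simp: inc_presheaf_def split: if_splits\<close>)
  qed
  ultimately show ?thesis
    by simp
qed

lemma restrict_map_inc_ty:
  "1 \<le> j \<Longrightarrow> j \<le> \<alpha> n \<Longrightarrow> ty_map (restrict_map (inc_presheaf n \<alpha>) h) j j = ty_map h j j"
  by (simp add: restrict_map_def inc_presheaf_def)

lemma restrict_map_inc_tm:
  "1 \<le> j \<Longrightarrow> j \<le> \<alpha> n \<Longrightarrow> j \<notin> \<alpha> ` {0..n} \<Longrightarrow>
    tm_map (restrict_map (inc_presheaf n \<alpha>) h) j j = tm_map h j j"
  by (simp add: restrict_map_def inc_presheaf_def)

text \<open>
  The components of \<open>h\<close> are arbitrary away from the elements of \<open>[\<alpha>]\<close> here. Restriction makes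
  them extensional, so the lemma serves to construct morphisms from values on \<open>[\<alpha>]\<close> as well as to
  restrict a morphism to a smaller \<open>[\<alpha>]\<close>.
\<close>

lemma restrict_map_inc_hom:
  assumes ty: "\<And>j. 1 \<le> j \<Longrightarrow> j \<le> \<alpha> n \<Longrightarrow> ty_map h j j \<in> ty X j"
    and bd: "\<And>j. 1 \<le> j \<Longrightarrow> j < \<alpha> n \<Longrightarrow> ty_map h j j = bd X j (ty_map h (Suc j) (Suc j))"
    and tm: "\<And>j. 1 \<le> j \<Longrightarrow> j \<le> \<alpha> n \<Longrightarrow> j \<notin> \<alpha> ` {0..n} \<Longrightarrow> tm_map h j j \<in> Tm X j (ty_map h j j)"
  shows "restrict_map (inc_presheaf n \<alpha>) h \<in> hom (inc_presheaf n \<alpha>) X"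
proof -
  let ?P = "inc_presheaf n \<alpha>" and ?h = "restrict_map (inc_presheaf n \<alpha>) h"
  have in_ty: "k = j \<and> j \<le> \<alpha> n" if "k \<in> ty ?P j" for j k
    using that by (simp add: inc_presheaf_def split: if_splits)
  have in_tm: "k = j \<and> j \<le> \<alpha> n \<and> j \<notin> \<alpha> ` {0..n}" if "k \<in> tm ?P j" for j k
    using that by (simp add: inc_presheaf_def split: if_splits)
  show ?thesis
    unfolding hom_def
  proof (intro CollectI conjI allI impI ballI)
    show "ty_map ?h \<in> (\<Pi>\<^sub>E j\<in>{1..}. ty ?P j \<rightarrow>\<^sub>E ty X j)"
    proof (intro PiE_I)
      fix j k assume "j \<in> {1..}" "k \<in> ty ?P j"
      then show "ty_map ?h j k \<in> ty X j"
        using in_ty[of k j] ty[of j] by (simp add: restrict_map_inc_ty)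
    qed (simp_all add: restrict_map_def)
    show "tm_map ?h \<in> (\<Pi>\<^sub>E j\<in>{1..}. tm ?P j \<rightarrow>\<^sub>E tm X j)"
    proof (intro PiE_I)
      fix j k assume "j \<in> {1..}" "k \<in> tm ?P j"
      then show "tm_map ?h j k \<in> tm X j"
        using in_tm[of k j] tm[of j] by (simp add: restrict_map_inc_tm Tm_def)
    qed (simp_all add: restrict_map_def)
  next
    fix j k :: nat assume j: "1 \<le> j" "k \<in> ty ?P (Suc j)"
    then have k: "k = Suc j" "Suc j \<le> \<alpha> n"
      using in_ty by blast+
    have "bd ?P j k = j"
      by (simp add: inc_presheaf_def)
    then show "ty_map ?h j (bd ?P j k) = bd X j (ty_map ?h (Suc j) k)"
      using j(1) k bd[of j] by (simp add: restrict_map_inc_ty)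
  next
    fix j k :: nat assume j: "1 \<le> j" "k \<in> tm ?P j"
    then have k: "k = j" "j \<le> \<alpha> n" "j \<notin> \<alpha> ` {0..n}"
      using in_tm by blast+
    have "tbd ?P j k = j"
      by (simp add: inc_presheaf_def)
    then show "ty_map ?h j (tbd ?P j k) = tbd X j (tm_map ?h j k)"
      using j(1) k tm[of j] by (simp add: restrict_map_inc_ty restrict_map_inc_tm Tm_def)
  qed
qed

lemma ident_type_eq_slot_type:
  assumes "\<alpha> \<in> Inc n" "h \<in> hom (inc_presheaf n \<alpha>) X" "1 \<le> i" "i \<le> n"
  shows "ident_type n \<alpha> h i =
    slot_type (inc_slots n \<alpha> h) (\<alpha> i) (ancestor X (\<alpha> n) (\<alpha> i) (ty_map h (\<alpha> n) (\<alpha> n)))"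
  using hom_inc_ancestor[OF assms(2), of "\<alpha> i"] Inc_pos[OF assms(1), of i] Inc_le[OF assms(1), of i n]
    assms(3,4)
  by (simp add: ident_type_def slot_type_def arg_expr_eq_slot_expr)

lemma ident_ctx_eq_slot_ctx:
  assumes "\<alpha> \<in> Inc n" "h \<in> hom (inc_presheaf n \<alpha>) X"
  shows "ident_ctx n \<alpha> h = slot_ctx X (inc_slots n \<alpha> h) (\<alpha> n) (ty_map h (\<alpha> n) (\<alpha> n))"
proof -
  have "slot_decl X (inc_slots n \<alpha> h) (\<alpha> n) (ty_map h (\<alpha> n) (\<alpha> n)) (\<alpha> i) = (i, ident_type n \<alpha> h i)"
    if "i \<in> set [1..<n]" for i
    using that assms by (simp add: slot_decl_def ident_type_eq_slot_type inc_slots_Inl)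
  then show ?thesis
    by (simp add: ident_ctx_def slot_ctx_def var_slots_inc_slots[OF assms(1)])
qed

lemma valid_inc_slots:
  assumes n: "1 \<le> n" and \<alpha>: "\<alpha> \<in> Inc n" and h: "h \<in> hom (inc_presheaf n \<alpha>) X"
  shows "valid_slots X (inc_slots n \<alpha> h) (\<alpha> n) (ty_map h (\<alpha> n) (\<alpha> n))"
  unfolding valid_slots_def
proof (intro conjI ballI allI impI)
  show "1 \<le> \<alpha> n"
    using Inc_pos[OF \<alpha>] n by simp
  then show "ty_map h (\<alpha> n) (\<alpha> n) \<in> ty X (\<alpha> n)"
    by (intro hom_inc_ty[OF h]) auto
next
  fix i j assume *: "isl (inc_slots n \<alpha> h i) \<and> inc_slots n \<alpha> h i = inc_slots n \<alpha> h j"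
  then have "isl (inc_slots n \<alpha> h i)" "isl (inc_slots n \<alpha> h j)"
    by auto
  then obtain i' j' where "i' \<in> {1..n}" "i = \<alpha> i'" "j' \<in> {1..n}" "j = \<alpha> j'"
    unfolding isl_inc_slots by blast
  then show "i = j"
    using * inc_slots_Inl[OF \<alpha>, of i' h] inc_slots_Inl[OF \<alpha>, of j' h] by simp
next
  fix j b assume j: "j \<in> {1..<\<alpha> n}" "inc_slots n \<alpha> h j = Inr b"
  then have "j \<notin> \<alpha> ` {1..n}" "b = tm_map h j j"
    by (auto simp: inc_slots_def split: if_splits)
  then show "b \<in> Tm X j (ancestor X (\<alpha> n) j (ty_map h (\<alpha> n) (\<alpha> n)))"
    using hom_inc_tm[OF h, of j] hom_inc_ancestor[OF h, of j] Inc_image[OF \<alpha>, of j] j(1) by simp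
qed

lemma ident_term_eq_slot_term:
  "App (Inr (\<alpha> n, a)) (map (arg_expr n \<alpha> h) [1..<\<alpha> n]) = slot_term (inc_slots n \<alpha> h) (\<alpha> n) a"
  by (simp add: slot_term_def arg_expr_eq_slot_expr)

lemma ident_derived:
  assumes X: "presheaf X" and n: "1 \<le> n" and \<alpha>: "\<alpha> \<in> Inc n" and h: "h \<in> hom (inc_presheaf n \<alpha>) X"
  shows "ident_type_judgement n \<alpha> h \<in> derived (free_gat X)"
    and "a \<in> Tm X (\<alpha> n) (ty_map h (\<alpha> n) (\<alpha> n)) \<Longrightarrow>
      ident_term_judgement n \<alpha> h a \<in> derived (free_gat X)"
proof -
  let ?A = "ty_map h (\<alpha> n) (\<alpha> n)" and ?p = "inc_slots n \<alpha> h"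
  have ty: "ident_type n \<alpha> h n = slot_type ?p (\<alpha> n) ?A"
    using ident_type_eq_slot_type[OF \<alpha> h n order_refl] by (simp only: ancestor_self)
  have d: "(ident_ctx n \<alpha> h \<turnstile> R) \<in> derived (free_gat X)" if "R \<in> slot_rhs X ?p (\<alpha> n) ?A" for R
    unfolding ident_ctx_eq_slot_ctx[OF \<alpha> h]
    by (rule slot_judgement_derived[OF X valid_inc_slots[OF n \<alpha> h] that])
  show "ident_type_judgement n \<alpha> h \<in> derived (free_gat X)"
    unfolding ident_type_judgement_def ty by (rule d) (simp add: slot_rhs_def)
  show "ident_term_judgement n \<alpha> h a \<in> derived (free_gat X)" if "a \<in> Tm X (\<alpha> n) ?A"
    unfolding ident_term_judgement_def ty ident_term_eq_slot_term
    by (rule d) (use that in \<open>auto simp: slot_rhs_def\<close>)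
qed

text \<open>
  The head constant of the \<open>i\<close>-th type is tagged with its degree \<open>\<alpha>(i)\<close>, which recovers \<open>\<alpha>\<close>. The
  head constant of the last type recovers \<open>h\<close> on type-elements, and the head constants of its
  arguments recover \<open>h\<close> on term-elements.
\<close>

lemma ident_type_judgement_inject:
  assumes n: "1 \<le> n" and \<alpha>: "\<alpha> \<in> Inc n" "h \<in> hom (inc_presheaf n \<alpha>) X"
    and \<beta>: "\<beta> \<in> Inc n" "k \<in> hom (inc_presheaf n \<beta>) X"
    and eq: "ident_type_judgement n \<alpha> h = ident_type_judgement n \<beta> k"
  shows "\<alpha> = \<beta> \<and> h = k"
proof -
  have ident: "ident_type n \<alpha> h i = ident_type n \<beta> k i" if "1 \<le> i" "i \<le> n" for i
    using eq that by (cases "i = n") (auto simp: ident_type_judgement_def ident_ctx_def)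
  have "\<alpha> = \<beta>"
  proof (rule extensionalityI[where A = "{0..n}"])
    fix i assume "i \<in> {0..n}"
    then show "\<alpha> i = \<beta> i"
      using ident[of i] Inc_0[OF \<alpha>(1)] Inc_0[OF \<beta>(1)] by (cases "i = 0") (auto simp: ident_type_def)
  qed (use \<alpha> \<beta> in \<open>auto simp: Inc_def\<close>)
  moreover have "h = k"
  proof (rule hom_inc_eqI[OF \<alpha>(2)])
    show k: "k \<in> hom (inc_presheaf n \<alpha>) X"
      using \<beta> \<open>\<alpha> = \<beta>\<close> by simp
    have "ty_map h (\<alpha> n) (\<alpha> n) = ty_map k (\<alpha> n) (\<alpha> n)"
      and args: "\<And>j. 1 \<le> j \<Longrightarrow> j < \<alpha> n \<Longrightarrow> arg_expr n \<alpha> h j = arg_expr n \<alpha> k j"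
      using ident[of n] n \<open>\<alpha> = \<beta>\<close> by (auto simp: ident_type_def)
    then show "ty_map h j j = ty_map k j j" if "1 \<le> j" "j \<le> \<alpha> n" for j
      using hom_inc_ancestor[OF \<alpha>(2) that] hom_inc_ancestor[OF k that] by metis
    fix j assume j: "1 \<le> j" "j \<le> \<alpha> n" "j \<notin> \<alpha> ` {0..n}"
    then have "j \<noteq> \<alpha> n" "j \<notin> \<alpha> ` {1..n}"
      by auto
    then show "tm_map h j j = tm_map k j j"
      using args[of j] j by (simp add: arg_expr_eq_slot_expr inc_slots_Inr slot_expr_Inr slot_term_def)
  qed
  ultimately show ?thesis
    by blast
qed

text \<open>
  The inc-list enumerates the slots that hold variables, followed by \<open>N\<close>; the permutation \<open>\<tau>\<close> sends
  the canonical variable \<open>i\<close> to the one found in the \<open>i\<close>-th of these slots.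
\<close>

lemma slots_normal_form:
  fixes p :: "nat \<Rightarrow> var + 'b"
  assumes X: "presheaf X" and p: "valid_slots X p N A" and n: "n = Suc (length (var_slots p N))"
  obtains \<alpha> h \<tau> where "\<alpha> \<in> Inc n" "h \<in> hom (inc_presheaf n \<alpha>) X" "\<alpha> n = N" "ty_map h N N = A"
    "bij \<tau>" "\<And>j. 1 \<le> j \<Longrightarrow> j < N \<Longrightarrow> rename_slots \<tau> (inc_slots n \<alpha> h) j = p j"
proof -
  \<comment> \<open>The leading \<open>0\<close> is the value \<open>\<alpha> 0 = 0\<close> required of an inc-list; \<open>0\<close> is not a slot.\<close>
  define xs where "xs = 0 # var_slots p N @ [N]"
  define \<alpha> where "\<alpha> = restrict (\<lambda>i. xs ! i) {0..n}"
  have N: "1 \<le> N" and A: "A \<in> ty X N"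
    using p by (auto simp: valid_slots_def)
  have "sorted_wrt (<) (var_slots p N)"
    unfolding var_slots_def by (intro sorted_wrt_filter) simp
  then have "sorted_wrt (<) xs"
    using N by (auto simp: xs_def sorted_wrt_append set_var_slots)
  then have \<alpha>: "\<alpha> \<in> Inc n"
    using sorted_wrt_nth_less[of "(<)" xs]
    by (auto simp: Inc_def \<alpha>_def strict_mono_on_def n xs_def)
  have \<alpha>n: "\<alpha> n = N"
    by (simp add: \<alpha>_def xs_def n nth_append)
  have \<alpha>i: "\<alpha> i = var_slots p N ! (i - 1)" if "1 \<le> i" "i < n" for i
    using that by (auto simp: \<alpha>_def xs_def n nth_append nth_Cons')
  have \<alpha>_img: "j \<in> \<alpha> ` {1..n} \<longleftrightarrow> isl (p j)" if j: "1 \<le> j" "j < N" for j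
  proof
    assume "j \<in> \<alpha> ` {1..n}"
    then obtain i where "1 \<le> i" "i < n" "j = \<alpha> i"
      using \<alpha>n j by (metis atLeastAtMost_iff image_iff le_eq_less_or_eq less_irrefl)
    then have "j \<in> set (var_slots p N)"
      using \<alpha>i[of i] n by simp
    then show "isl (p j)"
      by (simp add: set_var_slots)
  next
    assume "isl (p j)"
    then have "j \<in> set (var_slots p N)"
      using j by (simp add: set_var_slots)
    then obtain i where "i < length (var_slots p N)" "j = var_slots p N ! i"
      by (metis in_set_conv_nth)
    then show "j \<in> \<alpha> ` {1..n}"
      using \<alpha>i[of "Suc i"] n by (intro image_eqI[of _ _ "Suc i"]) auto
  qed
  let ?P = "inc_presheaf n \<alpha>"
  define k :: "(nat, nat, 'a, 'b) tt_map" where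
    "k = \<lparr>ty_map = (\<lambda>j _. ancestor X N j A), tm_map = (\<lambda>j _. projr (p j))\<rparr>"
  define h where "h = restrict_map ?P k"
  have tm: "projr (p j) \<in> Tm X j (ancestor X N j A)" if "1 \<le> j" "j \<le> N" "j \<notin> \<alpha> ` {0..n}" for j
  proof -
    have "j \<noteq> N"
      using that(3) \<alpha>n by auto
    then have "\<not> isl (p j)"
      using that \<alpha>_img[of j] Inc_image[OF \<alpha>, of j] by simp
    then have "p j = Inr (projr (p j))"
      by simp
    then show ?thesis
      using p that \<open>j \<noteq> N\<close> unfolding valid_slots_def by fastforce
  qed
  have h: "h \<in> hom ?P X"
    unfolding h_def
  proof (rule restrict_map_inc_hom)
    fix j assume j: "1 \<le> j" "j \<le> \<alpha> n"
    then show "ty_map k j j \<in> ty X j"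
      using ancestor_in_ty[OF X j(1) _ A] \<alpha>n by (simp add: k_def)
    assume "j \<notin> \<alpha> ` {0..n}"
    then show "tm_map k j j \<in> Tm X j (ty_map k j j)"
      using tm[of j] j \<alpha>n by (simp add: k_def)
  next
    fix j assume "1 \<le> j" "j < \<alpha> n"
    then show "ty_map k j j = bd X j (ty_map k (Suc j) (Suc j))"
      using ancestor_ancestor[of j "Suc j" N X A] \<alpha>n by (simp add: k_def ancestor_Suc)
  qed
  have top: "ty_map h N N = A"
    using restrict_map_inc_ty[of N \<alpha> n k] N \<alpha>n by (simp add: h_def k_def)
  have isl_\<alpha>: "isl (p (\<alpha> i)) \<and> 1 \<le> \<alpha> i \<and> \<alpha> i < N" if "i \<in> {1..<n}" for i
    using \<alpha>_img[of "\<alpha> i"] Inc_pos[OF \<alpha>, of i] Inc_strict[OF \<alpha>, of i n] \<alpha>n that by auto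
  have "inj_on (\<lambda>i. projl (p (\<alpha> i))) {1..<n}"
  proof (rule inj_onI)
    fix i j assume ij: "i \<in> {1..<n}" "j \<in> {1..<n}" "projl (p (\<alpha> i)) = projl (p (\<alpha> j))"
    then have "p (\<alpha> i) = p (\<alpha> j)"
      using isl_\<alpha>[of i] isl_\<alpha>[of j] by (intro sum.expand) auto
    then have "\<alpha> i = \<alpha> j"
      using p isl_\<alpha>[of i] isl_\<alpha>[of j] ij by (auto simp: valid_slots_def)
    then show "i = j"
      using Inc_inj[OF \<alpha>] ij by (auto dest: inj_onD)
  qed
  then obtain \<tau> where \<tau>: "bij \<tau>" "\<And>i. i \<in> {1..<n} \<Longrightarrow> \<tau> i = projl (p (\<alpha> i))"
    using ex_bij_extending[of "{1..<n}" "\<lambda>i. projl (p (\<alpha> i))"] by auto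
  have "rename_slots \<tau> (inc_slots n \<alpha> h) j = p j" if j: "1 \<le> j" "j < N" for j
  proof (cases "isl (p j)")
    case True
    then obtain i where i: "i \<in> {1..n}" "j = \<alpha> i"
      using \<alpha>_img[OF j] by auto
    then have "i \<in> {1..<n}"
      using j \<alpha>n by (cases "i = n") auto
    then show ?thesis
      using True i \<tau>(2)[of i] inc_slots_Inl[OF \<alpha>, of i h] by (simp add: rename_slots_def)
  next
    case False
    then have "j \<notin> \<alpha> ` {0..n}" "j \<notin> \<alpha> ` {1..n}"
      using \<alpha>_img[OF j] Inc_image[OF \<alpha> j(1)] by auto
    then show ?thesis
      using False j restrict_map_inc_tm[of j \<alpha> n k] \<alpha>n
      by (cases "p j") (simp_all add: rename_slots_def inc_slots_Inr h_def k_def)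
  qed
  then show thesis
    using that[OF \<alpha> h \<alpha>n top \<tau>(1)] by blast
qed

lemma rename_ident:
  assumes \<alpha>: "\<alpha> \<in> Inc n" and h: "h \<in> hom (inc_presheaf n \<alpha>) X" and n: "1 \<le> n"
    and p: "\<And>j. 1 \<le> j \<Longrightarrow> j < \<alpha> n \<Longrightarrow> rename_slots \<tau> (inc_slots n \<alpha> h) j = p j"
  defines "A \<equiv> ty_map h (\<alpha> n) (\<alpha> n)"
  shows "permute \<tau> (ident_type_judgement n \<alpha> h) =
      (slot_ctx X p (\<alpha> n) A \<turnstile> IsType (slot_type p (\<alpha> n) A))"
    and "permute \<tau> (ident_term_judgement n \<alpha> h a) =
      (slot_ctx X p (\<alpha> n) A \<turnstile> HasType (slot_term p (\<alpha> n) a) (slot_type p (\<alpha> n) A))"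
proof -
  let ?q = "inc_slots n \<alpha> h"
  have ctx: "permute_ctx \<tau> (ident_ctx n \<alpha> h) = slot_ctx X p (\<alpha> n) A"
    unfolding ident_ctx_eq_slot_ctx[OF \<alpha> h] slot_ctx_rename_slots[symmetric] A_def
    by (rule slot_ctx_cong) (rule p)
  have e: "subst (Var \<circ> \<tau>) (slot_expr ?q j) = (slot_expr p j :: (nat \<times> 'a + nat \<times> 'b) expr)"
    if "1 \<le> j" "j < \<alpha> n" for j
  proof -
    have "slot_expr (rename_slots \<tau> ?q) j = (slot_expr p j :: (nat \<times> 'a + nat \<times> 'b) expr)"
      using that by (intro slot_expr_cong p) auto
    then show ?thesis
      using subst_rename_slots[OF that(1)] by metis
  qed
  have ty: "subst (Var \<circ> \<tau>) (ident_type n \<alpha> h n) = slot_type p (\<alpha> n) A"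
    using n unfolding ident_type_eq_slot_type[OF \<alpha> h n order_refl] ancestor_self A_def
    by (intro subst_slot_type e)
  have tm: "subst (Var \<circ> \<tau>) (slot_term ?q (\<alpha> n) a) =
      (slot_term p (\<alpha> n) a :: (nat \<times> 'a + nat \<times> 'b) expr)"
    by (intro subst_slot_term e)
  show "permute \<tau> (ident_type_judgement n \<alpha> h) =
      (slot_ctx X p (\<alpha> n) A \<turnstile> IsType (slot_type p (\<alpha> n) A))"
    by (simp add: permute_def ident_type_judgement_def ctx ty)
  show "permute \<tau> (ident_term_judgement n \<alpha> h a) =
      (slot_ctx X p (\<alpha> n) A \<turnstile> HasType (slot_term p (\<alpha> n) a) (slot_type p (\<alpha> n) A))"
    unfolding permute_def ident_term_judgement_def ident_term_eq_slot_term judgement.sel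
      subst_rhs.simps ctx ty tm ..
qed

section \<open>Representatives of the classes\<close>

lemma derived_type_normal_form:
  assumes X: "presheaf X" and J: "J \<in> derived (free_gat X)" "is_type_judgement J"
  obtains \<alpha> h \<tau> where "\<alpha> \<in> Inc (degree J)" "h \<in> hom (inc_presheaf (degree J) \<alpha>) X" "bij \<tau>"
    "J = permute \<tau> (ident_type_judgement (degree J) \<alpha> h)"
proof -
  obtain \<Gamma> S where \<Gamma>: "J = (\<Gamma> \<turnstile> IsType S)"
    using J(2) by (auto simp: is_type_judgement_def)
  obtain p N A where p: "valid_slots X p N A" "\<Gamma> = slot_ctx X p N A" "S = slot_type p N A"
    using J(1) unfolding \<Gamma> by (rule derived_IsTypeE)
  define n where "n = degree J"
  have n: "n = Suc (length (var_slots p N))"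
    by (simp add: n_def degree_def \<Gamma> p(2) slot_ctx_def)
  obtain \<alpha> h \<tau> where *: "\<alpha> \<in> Inc n" "h \<in> hom (inc_presheaf n \<alpha>) X" "\<alpha> n = N" "ty_map h N N = A"
    "bij \<tau>" "\<And>j. 1 \<le> j \<Longrightarrow> j < N \<Longrightarrow> rename_slots \<tau> (inc_slots n \<alpha> h) j = p j"
    using slots_normal_form[OF X p(1) n] by blast
  have "permute \<tau> (ident_type_judgement n \<alpha> h) = J"
    using rename_ident(1)[OF *(1,2), of \<tau> p] * n unfolding \<Gamma> p(2,3) by simp
  then show thesis
    using that *(1,2,5) unfolding n_def by metis
qed

lemma derived_term_normal_form:
  assumes X: "presheaf X" and J: "J \<in> derived (free_gat X)" "is_term_judgement J"
  obtains \<alpha> h a \<tau> where "\<alpha> \<in> Inc (degree J)" "h \<in> hom (inc_presheaf (degree J) \<alpha>) X"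
    "a \<in> Tm X (\<alpha> (degree J)) (ty_map h (\<alpha> (degree J)) (\<alpha> (degree J)))" "bij \<tau>"
    "J = permute \<tau> (ident_term_judgement (degree J) \<alpha> h a)"
proof -
  obtain \<Gamma> s S where \<Gamma>: "J = (\<Gamma> \<turnstile> HasType s S)"
    using J(2) by (auto simp: is_term_judgement_def)
  obtain p N A a where p: "valid_slots X p N A" "\<Gamma> = slot_ctx X p N A" "S = slot_type p N A"
      "a \<in> Tm X N A" "s = slot_term p N a"
    using J(1) unfolding \<Gamma> by (rule derived_HasTypeE)
  define n where "n = degree J"
  have n: "n = Suc (length (var_slots p N))"
    by (simp add: n_def degree_def \<Gamma> p(2) slot_ctx_def)
  obtain \<alpha> h \<tau> where *: "\<alpha> \<in> Inc n" "h \<in> hom (inc_presheaf n \<alpha>) X" "\<alpha> n = N" "ty_map h N N = A"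
    "bij \<tau>" "\<And>j. 1 \<le> j \<Longrightarrow> j < N \<Longrightarrow> rename_slots \<tau> (inc_slots n \<alpha> h) j = p j"
    using slots_normal_form[OF X p(1) n] by blast
  have "permute \<tau> (ident_term_judgement n \<alpha> h a) = J"
    using rename_ident(2)[OF *(1,2), of \<tau> p a] * n unfolding \<Gamma> p(2,3,5) by simp
  moreover have "a \<in> Tm X (\<alpha> n) (ty_map h (\<alpha> n) (\<alpha> n))"
    using p(4) *(3,4) by simp
  ultimately show thesis
    using that *(1,2,5) unfolding n_def by metis
qed

lemma inc_bd_Inc: "\<alpha> \<in> Inc (Suc n) \<Longrightarrow> inc_bd n \<alpha> \<in> Inc n"
  by (auto simp: Inc_def inc_bd_def strict_mono_on_def)

lemma inc_bd_apply: "i \<le> n \<Longrightarrow> inc_bd n \<alpha> i = \<alpha> i"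
  by (simp add: inc_bd_def)

lemma inc_bd_image:
  assumes "\<alpha> \<in> Inc (Suc n)" "j \<le> \<alpha> n"
  shows "j \<in> inc_bd n \<alpha> ` {m..n} \<longleftrightarrow> j \<in> \<alpha> ` {m..Suc n}"
proof
  assume "j \<in> \<alpha> ` {m..Suc n}"
  then obtain i where i: "m \<le> i" "i \<le> Suc n" "j = \<alpha> i"
    by auto
  then have "i \<noteq> Suc n"
    using Inc_strict[OF assms(1), of n "Suc n"] assms(2) by auto
  then show "j \<in> inc_bd n \<alpha> ` {m..n}"
    using i by (intro image_eqI[of _ _ i]) (auto simp: inc_bd_apply)
qed (auto simp: inc_bd_apply)

lemma restrict_map_inc_bd:
  assumes \<alpha>: "\<alpha> \<in> Inc (Suc n)" and h: "h \<in> hom (inc_presheaf (Suc n) \<alpha>) X"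
  shows "restrict_map (inc_presheaf n (inc_bd n \<alpha>)) h \<in> hom (inc_presheaf n (inc_bd n \<alpha>)) X"
proof (rule restrict_map_inc_hom)
  have less: "\<alpha> n < \<alpha> (Suc n)"
    using Inc_strict[OF \<alpha>, of n "Suc n"] by simp
  fix j assume j: "1 \<le> j" "j \<le> inc_bd n \<alpha> n"
  then have j': "j \<le> \<alpha> n"
    by (simp add: inc_bd_apply)
  then show "ty_map h j j \<in> ty X j"
    using hom_inc_ty[OF h j(1)] less by simp
  assume "j \<notin> inc_bd n \<alpha> ` {0..n}"
  then show "tm_map h j j \<in> Tm X j (ty_map h j j)"
    using hom_inc_tm[OF h j(1)] j' less inc_bd_image[OF \<alpha> j'] by simp
next
  fix j assume "1 \<le> j" "j < inc_bd n \<alpha> n"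
  then show "ty_map h j j = bd X j (ty_map h (Suc j) (Suc j))"
    using Inc_strict[OF \<alpha>, of n "Suc n"] by (intro hom_inc_bd[OF h]) (auto simp: inc_bd_apply)
qed

text \<open>
  The types declared before position \<open>n\<close>, and the one at position \<open>n\<close>, have degree at most \<open>\<alpha>(n)\<close>.
  They only involve slots below \<open>\<alpha>(n)\<close>, where \<open>\<alpha>\<close> and its restriction make the same assignment.
\<close>

lemma boundary_ident_type:
  assumes n: "1 \<le> n" and \<alpha>: "\<alpha> \<in> Inc (Suc n)"
  shows "boundary (ident_type_judgement (Suc n) \<alpha> h) =
    [ident_type_judgement n (inc_bd n \<alpha>) (restrict_map (inc_presheaf n (inc_bd n \<alpha>)) h)]"
proof -
  let ?\<beta> = "inc_bd n \<alpha>"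
  let ?k = "restrict_map (inc_presheaf n ?\<beta>) h"
  have \<beta>: "?\<beta> \<in> Inc n"
    using \<alpha> by (rule inc_bd_Inc)
  have slots: "inc_slots n ?\<beta> ?k j = inc_slots (Suc n) \<alpha> h j" if j: "1 \<le> j" "j \<le> \<alpha> n" for j
  proof (cases "j \<in> \<alpha> ` {1..Suc n}")
    case True
    then have "j \<in> ?\<beta> ` {1..n}"
      using inc_bd_image[OF \<alpha> j(2)] by simp
    then obtain i where i: "1 \<le> i" "i \<le> n" "j = ?\<beta> i"
      by auto
    then have "j = \<alpha> i"
      by (simp add: inc_bd_apply)
    then show ?thesis
      using inc_slots_Inl[OF \<beta> i(1,2), of ?k] inc_slots_Inl[OF \<alpha> i(1), of h] i(2,3) by simp
  next
    case False
    then have "j \<notin> ?\<beta> ` {1..n}"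
      using inc_bd_image[OF \<alpha> j(2)] by simp
    then have "tm_map ?k j j = tm_map h j j"
      using j Inc_image[OF \<beta> j(1)] by (intro restrict_map_inc_tm) (auto simp: inc_bd_apply)
    with \<open>j \<notin> ?\<beta> ` {1..n}\<close> show ?thesis
      using False by (simp add: inc_slots_Inr)
  qed
  have ident: "ident_type n ?\<beta> ?k i = ident_type (Suc n) \<alpha> h i" if i: "1 \<le> i" "i \<le> n" for i
  proof -
    have le: "1 \<le> \<alpha> i" "\<alpha> i \<le> \<alpha> n"
      using Inc_pos[OF \<alpha>, of i] Inc_le[OF \<alpha>, of i n] i by auto
    have "map (slot_expr (inc_slots n ?\<beta> ?k)) [1..<\<alpha> i] =
        map (slot_expr (inc_slots (Suc n) \<alpha> h)) [1..<\<alpha> i]"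
      using le(2) by (intro map_slot_expr_cong slots) auto
    moreover have "ty_map ?k (\<alpha> i) (\<alpha> i) = ty_map h (\<alpha> i) (\<alpha> i)"
      using le by (intro restrict_map_inc_ty) (auto simp: inc_bd_apply)
    ultimately show ?thesis
      using i by (simp add: ident_type_def arg_expr_eq_slot_expr[abs_def] inc_bd_apply)
  qed
  then have "ident_ctx (Suc n) \<alpha> h = ident_ctx n ?\<beta> ?k @ [(n, ident_type n ?\<beta> ?k n)]"
    using n by (simp add: ident_ctx_def)
  then show ?thesis
    by (simp add: ident_type_judgement_def)
qed

lemma boundary_ident_term:
  "boundary (ident_term_judgement n \<alpha> h a) = [ident_type_judgement n \<alpha> h]"
  by (simp add: ident_term_judgement_def ident_type_judgement_def)

lemma ident_kind:
  "is_type_judgement (ident_type_judgement n \<alpha> h)"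
  "is_term_judgement (ident_term_judgement n \<alpha> h a)"
  by (auto simp: ident_type_judgement_def ident_term_judgement_def is_type_judgement_def
      is_term_judgement_def)

lemma ident_degree:
  assumes "1 \<le> n"
  shows "degree (ident_type_judgement n \<alpha> h) = n" "degree (ident_term_judgement n \<alpha> h a) = n"
  using assms by (simp_all add: ident_type_judgement_def ident_term_judgement_def degree_def ident_ctx_def)

lemma ident_term_judgement_inject:
  assumes "ident_term_judgement n \<alpha> h a = ident_term_judgement n \<beta> k b"
  shows "ident_type_judgement n \<alpha> h = ident_type_judgement n \<beta> k \<and> a = b"
  using assms by (simp add: ident_type_judgement_def ident_term_judgement_def)

text \<open>
  Judgements attached to inc-lists of the same length declare the same variables, so if they are
  equivalent, they are equal.
\<close>

lemma ident_type_class_inject: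
  assumes X: "presheaf X" and n: "1 \<le> n"
    and \<alpha>: "\<alpha> \<in> Inc n" "h \<in> hom (inc_presheaf n \<alpha>) X"
    and \<beta>: "\<beta> \<in> Inc n" "k \<in> hom (inc_presheaf n \<beta>) X"
    and eq: "equiv_rel (free_gat X) `` {ident_type_judgement n \<alpha> h} =
      equiv_rel (free_gat X) `` {ident_type_judgement n \<beta> k}"
  shows "\<alpha> = \<beta> \<and> h = k"
proof -
  have "(ident_type_judgement n \<alpha> h, ident_type_judgement n \<beta> k) \<in> equiv_rel (free_gat X)"
    using eq ident_derived(1)[OF X n \<beta>]
    by (intro eq_equiv_class[OF _ equiv_equiv_rel[OF X]]) (auto simp: type_or_term_def ident_kind)
  then have "ident_type_judgement n \<alpha> h = ident_type_judgement n \<beta> k"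
    by (rule equiv_rel_same_vars[OF X]) (simp add: ident_type_judgement_def ident_ctx_def comp_def)
  then show ?thesis
    by (rule ident_type_judgement_inject[OF n \<alpha> \<beta>])
qed

lemma ident_term_class_inject:
  assumes X: "presheaf X" and n: "1 \<le> n"
    and \<alpha>: "\<alpha> \<in> Inc n" "h \<in> hom (inc_presheaf n \<alpha>) X"
    and \<beta>: "\<beta> \<in> Inc n" "k \<in> hom (inc_presheaf n \<beta>) X" "b \<in> Tm X (\<beta> n) (ty_map k (\<beta> n) (\<beta> n))"
    and eq: "equiv_rel (free_gat X) `` {ident_term_judgement n \<alpha> h a} =
      equiv_rel (free_gat X) `` {ident_term_judgement n \<beta> k b}"
  shows "\<alpha> = \<beta> \<and> h = k \<and> a = b"
proof -
  have "(ident_term_judgement n \<alpha> h a, ident_term_judgement n \<beta> k b) \<in> equiv_rel (free_gat X)"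
    using eq ident_derived(2)[OF X n \<beta>]
    by (intro eq_equiv_class[OF _ equiv_equiv_rel[OF X]]) (auto simp: type_or_term_def ident_kind)
  then have "ident_term_judgement n \<alpha> h a = ident_term_judgement n \<beta> k b"
    by (rule equiv_rel_same_vars[OF X]) (simp add: ident_term_judgement_def ident_ctx_def comp_def)
  then show ?thesis
    using ident_term_judgement_inject ident_type_judgement_inject[OF n \<alpha> \<beta>(1,2)] by metis
qed


section \<open>The substitution monad\<close>

lemma type_class_iff:
  assumes X: "presheaf X" and n: "1 \<le> n"
  shows "C \<in> ty (substitution_monad X) n \<longleftrightarrow>
    (\<exists>(\<alpha>, h)\<in>ty (inc_structure X) n. C = equiv_rel (free_gat X) `` {ident_type_judgement n \<alpha> h})"
proof
  assume "C \<in> ty (substitution_monad X) n"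
  then obtain J where J: "J \<in> derived (free_gat X)" "is_type_judgement J" "degree J = n"
      and C: "C = equiv_rel (free_gat X) `` {J}"
    by (auto simp: substitution_monad_def forgetful_def elim!: quotientE)
  obtain \<alpha> h \<tau> where *: "\<alpha> \<in> Inc n" "h \<in> hom (inc_presheaf n \<alpha>) X" "bij \<tau>"
      "J = permute \<tau> (ident_type_judgement n \<alpha> h)"
    using derived_type_normal_form[OF X J(1,2)] J(3) by metis
  have "(J, ident_type_judgement n \<alpha> h) \<in> equiv_rel (free_gat X)"
    using J(1,2) * ident_derived(1)[OF X n *(1,2)] equiv_rel_iff_permute[OF X]
    unfolding type_or_term_def by blast
  then have "C = equiv_rel (free_gat X) `` {ident_type_judgement n \<alpha> h}"
    unfolding C by (rule equiv_class_eq[OF equiv_equiv_rel[OF X]])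
  then show "\<exists>(\<alpha>, h)\<in>ty (inc_structure X) n. C = equiv_rel (free_gat X) `` {ident_type_judgement n \<alpha> h}"
    using *(1,2) by (auto simp: inc_structure_def)
next
  assume "\<exists>(\<alpha>, h)\<in>ty (inc_structure X) n. C = equiv_rel (free_gat X) `` {ident_type_judgement n \<alpha> h}"
  then show "C \<in> ty (substitution_monad X) n"
    using n by (auto simp: inc_structure_def substitution_monad_def forgetful_def ident_kind
        ident_degree intro!: quotientI ident_derived[OF X])
qed

lemma term_class_iff:
  assumes X: "presheaf X" and n: "1 \<le> n"
  shows "C \<in> tm (substitution_monad X) n \<longleftrightarrow>
    (\<exists>((\<alpha>, h), a)\<in>tm (inc_structure X) n.
      C = equiv_rel (free_gat X) `` {ident_term_judgement n \<alpha> h a})"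
proof
  assume "C \<in> tm (substitution_monad X) n"
  then obtain J where J: "J \<in> derived (free_gat X)" "is_term_judgement J" "degree J = n"
      and C: "C = equiv_rel (free_gat X) `` {J}"
    by (auto simp: substitution_monad_def forgetful_def elim!: quotientE)
  obtain \<alpha> h a \<tau> where *: "\<alpha> \<in> Inc n" "h \<in> hom (inc_presheaf n \<alpha>) X"
      "a \<in> Tm X (\<alpha> n) (ty_map h (\<alpha> n) (\<alpha> n))" "bij \<tau>"
      "J = permute \<tau> (ident_term_judgement n \<alpha> h a)"
    using derived_term_normal_form[OF X J(1,2)] J(3) by metis
  have "(J, ident_term_judgement n \<alpha> h a) \<in> equiv_rel (free_gat X)"
    using J(1,2) * ident_derived(2)[OF X n *(1-3)] equiv_rel_iff_permute[OF X]
    unfolding type_or_term_def by blast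
  then have "C = equiv_rel (free_gat X) `` {ident_term_judgement n \<alpha> h a}"
    unfolding C by (rule equiv_class_eq[OF equiv_equiv_rel[OF X]])
  then show "\<exists>((\<alpha>, h), a)\<in>tm (inc_structure X) n.
      C = equiv_rel (free_gat X) `` {ident_term_judgement n \<alpha> h a}"
    using *(1-3) by (force simp: inc_structure_def)
next
  assume "\<exists>((\<alpha>, h), a)\<in>tm (inc_structure X) n.
      C = equiv_rel (free_gat X) `` {ident_term_judgement n \<alpha> h a}"
  then show "C \<in> tm (substitution_monad X) n"
    using n by (auto simp: inc_structure_def substitution_monad_def forgetful_def ident_kind
        ident_degree intro!: quotientI ident_derived[OF X])
qed

lemma boundary_type_class:
  assumes X: "presheaf X" and n: "1 \<le> n" and \<alpha>: "(\<alpha>, h) \<in> ty (inc_structure X) (Suc n)"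
  shows "bd (substitution_monad X) n (equiv_rel (free_gat X) `` {ident_type_judgement (Suc n) \<alpha> h}) =
    equiv_rel (free_gat X) `` {ident_type_judgement n (inc_bd n \<alpha>)
      (restrict_map (inc_presheaf n (inc_bd n \<alpha>)) h)}"
proof -
  have \<alpha>: "\<alpha> \<in> Inc (Suc n)" "h \<in> hom (inc_presheaf (Suc n) \<alpha>) X"
    using \<alpha> by (auto simp: inc_structure_def)
  have "ident_type_judgement (Suc n) \<alpha> h \<in> derived (free_gat X)"
    by (rule ident_derived[OF X _ \<alpha>]) simp
  then have "(\<Union>J\<in>equiv_rel (free_gat X) `` {ident_type_judgement (Suc n) \<alpha> h}.
      equiv_rel (free_gat X) `` set (boundary J)) =
    equiv_rel (free_gat X) `` {ident_type_judgement n (inc_bd n \<alpha>)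
      (restrict_map (inc_presheaf n (inc_bd n \<alpha>)) h)}"
    by (rule boundary_class[OF X _ _ boundary_ident_type[OF n \<alpha>(1)]])
      (simp add: type_or_term_def ident_kind)
  then show ?thesis
    by (simp add: substitution_monad_def forgetful_def)
qed

lemma boundary_term_class:
  assumes X: "presheaf X" and n: "1 \<le> n" and \<alpha>: "((\<alpha>, h), a) \<in> tm (inc_structure X) n"
  shows "tbd (substitution_monad X) n (equiv_rel (free_gat X) `` {ident_term_judgement n \<alpha> h a}) =
    equiv_rel (free_gat X) `` {ident_type_judgement n \<alpha> h}"
proof -
  have \<alpha>: "\<alpha> \<in> Inc n" "h \<in> hom (inc_presheaf n \<alpha>) X" "a \<in> Tm X (\<alpha> n) (ty_map h (\<alpha> n) (\<alpha> n))"
    using \<alpha> by (auto simp: inc_structure_def)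
  have "(\<Union>J\<in>equiv_rel (free_gat X) `` {ident_term_judgement n \<alpha> h a}.
      equiv_rel (free_gat X) `` set (boundary J)) =
    equiv_rel (free_gat X) `` {ident_type_judgement n \<alpha> h}"
    by (rule boundary_class[OF X ident_derived(2)[OF X n \<alpha>] _ boundary_ident_term])
      (simp add: type_or_term_def ident_kind)
  then show ?thesis
    by (simp add: substitution_monad_def forgetful_def)
qed

lemma inc_structure_bd:
  "(\<alpha>, h) \<in> ty (inc_structure X) (Suc n) \<Longrightarrow>
    (inc_bd n \<alpha>, restrict_map (inc_presheaf n (inc_bd n \<alpha>)) h) \<in> ty (inc_structure X) n"
  by (simp add: inc_structure_def inc_bd_Inc restrict_map_inc_bd)

lemma inc_structure_tbd:
  "((\<alpha>, h), a) \<in> tm (inc_structure X) n \<Longrightarrow> (\<alpha>, h) \<in> ty (inc_structure X) n"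
  by (simp add: inc_structure_def)

lemma presheaf_inc_structure: "presheaf (inc_structure X)"
  unfolding presheaf_def
proof (intro allI impI conjI funcsetI)
  fix n and x :: "(nat \<Rightarrow> nat) \<times> (nat, nat, 'a, 'b) tt_map"
  assume "x \<in> ty (inc_structure X) (Suc n)"
  then show "bd (inc_structure X) n x \<in> ty (inc_structure X) n"
    using inc_structure_bd[of "fst x" "snd x" X n] by (cases x) (simp add: inc_structure_def)
next
  fix n and x :: "((nat \<Rightarrow> nat) \<times> (nat, nat, 'a, 'b) tt_map) \<times> 'b"
  assume "x \<in> tm (inc_structure X) n"
  then show "tbd (inc_structure X) n x \<in> ty (inc_structure X) n"
    by (auto simp: inc_structure_def)
qed

lemma presheaf_substitution_monad:
  assumes X: "presheaf X"
  shows "presheaf (substitution_monad X)"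
  unfolding presheaf_def
proof (intro allI impI conjI funcsetI)
  fix n :: nat and C assume n: "1 \<le> n" and "C \<in> ty (substitution_monad X) (Suc n)"
  then obtain \<alpha> h where "(\<alpha>, h) \<in> ty (inc_structure X) (Suc n)"
      "C = equiv_rel (free_gat X) `` {ident_type_judgement (Suc n) \<alpha> h}"
    using type_class_iff[OF X, of "Suc n" C] by auto
  then show "bd (substitution_monad X) n C \<in> ty (substitution_monad X) n"
    using boundary_type_class[OF X n, of \<alpha> h] inc_structure_bd[of \<alpha> h X n]
    unfolding type_class_iff[OF X n] by auto
next
  fix n :: nat and C assume n: "1 \<le> n" and "C \<in> tm (substitution_monad X) n"
  then obtain \<alpha> h a where "((\<alpha>, h), a) \<in> tm (inc_structure X) n"
      "C = equiv_rel (free_gat X) `` {ident_term_judgement n \<alpha> h a}"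
    using term_class_iff[OF X n, of C] by auto
  then show "tbd (substitution_monad X) n C \<in> ty (substitution_monad X) n"
    using boundary_term_class[OF X n, of \<alpha> h a] inc_structure_tbd[of \<alpha> h a X n]
    unfolding type_class_iff[OF X n] by auto
qed

lemma identification_ty:
  "1 \<le> n \<Longrightarrow> (\<alpha>, h) \<in> ty (inc_structure X) n \<Longrightarrow>
    ty_map (identification X) n (\<alpha>, h) = equiv_rel (free_gat X) `` {ident_type_judgement n \<alpha> h}"
  by (simp add: identification_def)

lemma identification_tm:
  "1 \<le> n \<Longrightarrow> ((\<alpha>, h), a) \<in> tm (inc_structure X) n \<Longrightarrow>
    tm_map (identification X) n ((\<alpha>, h), a) =
      equiv_rel (free_gat X) `` {ident_term_judgement n \<alpha> h a}"
  by (simp add: identification_def)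

lemma bij_identification_ty:
  assumes X: "presheaf X" and n: "1 \<le> n"
  shows "bij_betw (ty_map (identification X) n) (ty (inc_structure X) n) (ty (substitution_monad X) n)"
proof (rule bij_betw_imageI)
  show "inj_on (ty_map (identification X) n) (ty (inc_structure X) n)"
  proof (rule inj_onI)
    fix x y
    assume xy: "x \<in> ty (inc_structure X) n" "y \<in> ty (inc_structure X) n"
      "ty_map (identification X) n x = ty_map (identification X) n y"
    obtain \<alpha> h \<beta> k where x: "x = (\<alpha>, h)" and y: "y = (\<beta>, k)"
      by (metis surj_pair)
    have *: "(\<alpha>, h) \<in> ty (inc_structure X) n" "(\<beta>, k) \<in> ty (inc_structure X) n"
      "ty_map (identification X) n (\<alpha>, h) = ty_map (identification X) n (\<beta>, k)"
      using xy unfolding x y .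
    then have "equiv_rel (free_gat X) `` {ident_type_judgement n \<alpha> h} =
        equiv_rel (free_gat X) `` {ident_type_judgement n \<beta> k}"
      using n by (simp add: identification_ty)
    then show "x = y"
      using *(1,2) ident_type_class_inject[OF X n, of \<alpha> h \<beta> k] unfolding x y
      by (simp add: inc_structure_def)
  qed
  show "ty_map (identification X) n ` ty (inc_structure X) n = ty (substitution_monad X) n"
  proof (rule set_eqI)
    fix C
    have "C \<in> ty_map (identification X) n ` ty (inc_structure X) n \<longleftrightarrow>
      (\<exists>(\<alpha>, h)\<in>ty (inc_structure X) n. C = equiv_rel (free_gat X) `` {ident_type_judgement n \<alpha> h})"
      using identification_ty[OF n, of _ _ X] by (force simp: image_iff)
    then show "C \<in> ty_map (identification X) n ` ty (inc_structure X) n \<longleftrightarrow>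
        C \<in> ty (substitution_monad X) n"
      using type_class_iff[OF X n] by simp
  qed
qed

lemma bij_identification_tm:
  assumes X: "presheaf X" and n: "1 \<le> n"
  shows "bij_betw (tm_map (identification X) n) (tm (inc_structure X) n) (tm (substitution_monad X) n)"
proof (rule bij_betw_imageI)
  show "inj_on (tm_map (identification X) n) (tm (inc_structure X) n)"
  proof (rule inj_onI)
    fix x y
    assume xy: "x \<in> tm (inc_structure X) n" "y \<in> tm (inc_structure X) n"
      "tm_map (identification X) n x = tm_map (identification X) n y"
    obtain \<alpha> h a \<beta> k b where x: "x = ((\<alpha>, h), a)" and y: "y = ((\<beta>, k), b)"
      by (metis surj_pair)
    have *: "((\<alpha>, h), a) \<in> tm (inc_structure X) n" "((\<beta>, k), b) \<in> tm (inc_structure X) n"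
      "tm_map (identification X) n ((\<alpha>, h), a) = tm_map (identification X) n ((\<beta>, k), b)"
      using xy unfolding x y .
    then have "equiv_rel (free_gat X) `` {ident_term_judgement n \<alpha> h a} =
        equiv_rel (free_gat X) `` {ident_term_judgement n \<beta> k b}"
      using n by (simp add: identification_tm)
    then show "x = y"
      using *(1,2) ident_term_class_inject[OF X n, of \<alpha> h \<beta> k b a] unfolding x y
      by (simp add: inc_structure_def)
  qed
  show "tm_map (identification X) n ` tm (inc_structure X) n = tm (substitution_monad X) n"
  proof (rule set_eqI)
    fix C
    have "C \<in> tm_map (identification X) n ` tm (inc_structure X) n \<longleftrightarrow>
      (\<exists>((\<alpha>, h), a)\<in>tm (inc_structure X) n.
        C = equiv_rel (free_gat X) `` {ident_term_judgement n \<alpha> h a})"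
      using identification_tm[OF n, of _ _ _ X] by (force simp: image_iff)
    then show "C \<in> tm_map (identification X) n ` tm (inc_structure X) n \<longleftrightarrow>
        C \<in> tm (substitution_monad X) n"
      using term_class_iff[OF X n] by simp
  qed
qed

lemma identification_hom:
  assumes X: "presheaf X"
  shows "identification X \<in> hom (inc_structure X) (substitution_monad X)"
  unfolding hom_def
proof (intro CollectI conjI allI impI ballI)
  show "ty_map (identification X) \<in>
      (\<Pi>\<^sub>E n\<in>{1..}. ty (inc_structure X) n \<rightarrow>\<^sub>E ty (substitution_monad X) n)"
  proof (rule PiE_I)
    fix n :: nat assume "n \<in> {1..}"
    then show "ty_map (identification X) n \<in> ty (inc_structure X) n \<rightarrow>\<^sub>E ty (substitution_monad X) n"
      using funcset_mem[OF bij_betw_imp_funcset[OF bij_identification_ty[OF X, of n]]]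
      by (intro PiE_I) (simp_all add: identification_def)
  qed (simp add: identification_def)
  show "tm_map (identification X) \<in>
      (\<Pi>\<^sub>E n\<in>{1..}. tm (inc_structure X) n \<rightarrow>\<^sub>E tm (substitution_monad X) n)"
  proof (rule PiE_I)
    fix n :: nat assume "n \<in> {1..}"
    then show "tm_map (identification X) n \<in> tm (inc_structure X) n \<rightarrow>\<^sub>E tm (substitution_monad X) n"
      using funcset_mem[OF bij_betw_imp_funcset[OF bij_identification_tm[OF X, of n]]]
      by (intro PiE_I) (simp_all add: identification_def)
  qed (simp add: identification_def)
next
  fix n :: nat and x assume n: "1 \<le> n" and x: "x \<in> ty (inc_structure X) (Suc n)"
  obtain \<alpha> h where \<alpha>: "x = (\<alpha>, h)"
    by fastforce
  have "bd (inc_structure X) n x = (inc_bd n \<alpha>, restrict_map (inc_presheaf n (inc_bd n \<alpha>)) h)"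
    by (simp add: \<alpha> inc_structure_def)
  then show "ty_map (identification X) n (bd (inc_structure X) n x) =
      bd (substitution_monad X) n (ty_map (identification X) (Suc n) x)"
    using x n boundary_type_class[OF X n] unfolding \<alpha>
    by (simp add: identification_ty inc_structure_bd)
next
  fix n :: nat and x assume n: "1 \<le> n" and x: "x \<in> tm (inc_structure X) n"
  obtain \<alpha> h a where \<alpha>: "x = ((\<alpha>, h), a)"
    by (metis surj_pair)
  have "tbd (inc_structure X) n x = (\<alpha>, h)"
    by (simp add: \<alpha> inc_structure_def)
  then show "ty_map (identification X) n (tbd (inc_structure X) n x) =
      tbd (substitution_monad X) n (tm_map (identification X) n x)"
    using x n boundary_term_class[OF X n] inc_structure_tbd unfolding \<alpha>
    by (metis identification_ty identification_tm)
qed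

theorem proposition30:
  fixes X :: "('a, 'b) type_term"
  assumes "presheaf X"
  shows "presheaf_iso (inc_structure X) (substitution_monad X) (identification X)"
  unfolding presheaf_iso_def
  using assms presheaf_inc_structure presheaf_substitution_monad identification_hom
    bij_identification_ty bij_identification_tm by blast

end
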